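(* Let $\mathcal{G}$ be an undirected, connected graph of order $n$ and let $m<n$. Let $S$ be a set of $m$ noise-free leaders. Then the total system error of the leader-follower dynamics $d\mathbf{x}=-M\mathbf{x}\,dt+\sigma\,d\mathbf{W}$ is $$\sum_{i=1}^n \Sigma_{i,i}=\frac{\sigma^2}{2}\Big(\frac{n}{\rho_S}\Big),$$ where $\rho_S$ is the joint centrality of $S$ in $\mathcal{G}$, $$\rho_S=n\Big(\frac{K_f}{n}+n\det(G)\det(L_S^+)+\frac12\mathrm{Tr}(Q)-\mathbf{1}_m^TQ\,\mathbf{e}_{l_1}\Big)^{-1}$$ (with $l_1\in S$ chosen arbitrarily). Moreover, the optimal leader set (among all sets of $m$ noise-free leaders) is $S^*=\arg\max_S\rho_S$, the set of $m$ nodes with maximal joint centrality.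
   Context: Setting. $\mathcal{G}$ is an undirected connected graph on nodes $\{1,\dots,n\}$ with symmetric adjacency matrix $A$ ($a_{i,j}=a_{j,i}>0$ if $(i,j)$ is an edge, $a_{i,j}=0$ otherwise), $D$ is the diagonal matrix with $d_{i,i}=\sum_j a_{i,j}$, and $L=D-A$ is the Laplacian. $B^+$ denotes the Moore-Penrose pseudoinverse of $B$. Dynamics and error. Let $S$ be a nonempty set of nodes (leaders), $k>0$, and $K$ the diagonal matrix with $K_{i,i}=k$ for $i\in S$ and $K_{i,i}=0$ otherwise; $M=L+K$. For $\sigma>0$ the dynamics are $d\mathbf{x}=-M\mathbf{x}\,dt+\sigma\,d\mathbf{W}$, with $\mathbf{W}$ a vector of $n$ independent standard Wiener processes. $\Sigma$ is the steady-state covariance matrix of $\mathbf{x}$, i.e. the solution of $M\Sigma+\Sigma M^T=\sigma^2 I$. The total system error is $\mathrm{tr}(\Sigma)=\sum_{i=1}^n\Sigma_{i,i}=\frac{\sigma^2}{2}\sum_{i=1}^n (M^{-1})_{i,i}$. The leaders are called noise-corrupted if $0<k<\infty$; for noise-free leaders the total system error means the limit of this quantity as $k\to\infty$. For given $m$, an optimal leader set is a set of $m$ nodes minimizing the total system error over all sets of $m$ nodes. Graph quantities. $K_f=n\,\mathrm{Tr}(L^+)$ is the Kirchhoff index. The biharmonic distance is $\gamma_{i,j}=(L^2)^+_{i,i}+(L^2)^+_{j,j}-2(L^2)^+_{i,j}=\sum_{l=1}^n(L^+_{l,i}-L^+_{l,j})^2$, and $\Gamma=(\gamma_{i,j})$.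 For a matrix $B\in\mathbb{R}^{n\times n}$ and a set $S$ of $m$ nodes, $B_S$ is the $m\times m$ submatrix with rows and columns indexed by $S$, ordered so that $l_1$ is first. Joint centrality. Given a set $S$ of $m$ nodes, $m<n$, and an arbitrary $l_1\in S$, let $N^{-1}$ be the notation for the $n\times n$ matrix with entries $N^{-1}_{i,j}=L^+_{i,j}-L^+_{i,l_1}-L^+_{j,l_1}+L^+_{l_1,l_1}$. Let $N^{-1}_{S\setminus l_1}$ be its $(m-1)\times(m-1)$ submatrix with rows and columns indexed by $S\setminus\{l_1\}$, let $G=(N^{-1}_{S\setminus l_1})^{-1}$, let $\bar G=\begin{bmatrix}0&0\\0&G\end{bmatrix}\in\mathbb{R}^{m\times m}$ (zero row and column corresponding to $l_1$), and let $Q=\bar G\,\Gamma_S\in\mathbb{R}^{m\times m}$. $\mathbf{1}_m$ is the all-ones vector in $\mathbb{R}^m$, and $\mathbf{e}_{l_1}$ is the standard basis vector of $\mathbb{R}^m$ for the position of $l_1$. For $m=1$, $G$ is the empty matrix with $\det(G)=1$ and $Q=0$. *)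

theory Defs
  imports
    "Graph_Theory.Pair_Digraph"
    "Graph_Theory.Digraph_Component"
    "Jordan_Normal_Form.Gauss_Jordan_Elimination"
    "Jordan_Normal_Form.Determinant"
begin

text \<open>Nodes are numbered from 0, so the node set of a graph of order \<open>n\<close> is \<open>{..<n}\<close>.\<close>

definition adjacency_matrix :: "nat \<Rightarrow> nat pair_pre_digraph \<Rightarrow> real mat \<Rightarrow> bool" where
  "adjacency_matrix n G A \<longleftrightarrow>
     A \<in> carrier_mat n n \<and> transpose_mat A = A \<and>
     (\<forall>i<n. \<forall>j<n. if (i, j) \<in> parcs G then A $$ (i, j) > 0 else A $$ (i, j) = 0)"

definition degree_matrix :: "real mat \<Rightarrow> real mat" where
  "degree_matrix A = mat_diag (dim_row A) (\<lambda>i. \<Sum>j<dim_col A. A $$ (i, j))"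

definition laplacian :: "real mat \<Rightarrow> real mat" where
  "laplacian A = degree_matrix A - A"

definition mat_trace :: "real mat \<Rightarrow> real" where
  "mat_trace B = (\<Sum>i<dim_row B. B $$ (i, i))"

text \<open>The four Penrose conditions; they determine the pseudoinverse uniquely.\<close>

definition is_pseudoinverse :: "real mat \<Rightarrow> real mat \<Rightarrow> bool" where
  "is_pseudoinverse B X \<longleftrightarrow>
     X \<in> carrier_mat (dim_col B) (dim_row B) \<and>
     B * X * B = B \<and> X * B * X = X \<and>
     transpose_mat (B * X) = B * X \<and> transpose_mat (X * B) = X * B"

definition pseudoinverse :: "real mat \<Rightarrow> real mat" where
  "pseudoinverse B = (THE X. is_pseudoinverse B X)"


definition leader_gain :: "nat \<Rightarrow> nat set \<Rightarrow> real \<Rightarrow> real mat" where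
  "leader_gain n S k = mat_diag n (\<lambda>i. if i \<in> S then k else 0)"

definition system_matrix :: "real mat \<Rightarrow> nat set \<Rightarrow> real \<Rightarrow> real mat" where
  "system_matrix A S k = laplacian A + leader_gain (dim_row A) S k"

text \<open>
  The steady-state covariance of \<open>dx = -M x dt + \<sigma> dW\<close>, as the solution of its Lyapunov
  equation.
\<close>

definition steady_state_covariance :: "real mat \<Rightarrow> real \<Rightarrow> real mat" where
  "steady_state_covariance M \<sigma> =
     (THE X. X \<in> carrier_mat (dim_row M) (dim_row M) \<and>
             M * X + X * transpose_mat M = \<sigma>\<^sup>2 \<cdot>\<^sub>m 1\<^sub>m (dim_row M))"

definition total_system_error :: "real mat \<Rightarrow> real \<Rightarrow> nat set \<Rightarrow> real \<Rightarrow> real" where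
  "total_system_error A \<sigma> S k = mat_trace (steady_state_covariance (system_matrix A S k) \<sigma>)"

definition noise_free_error :: "real mat \<Rightarrow> real \<Rightarrow> nat set \<Rightarrow> real" where
  "noise_free_error A \<sigma> S = Lim at_top (total_system_error A \<sigma> S)"

definition leader_sets :: "nat \<Rightarrow> nat \<Rightarrow> nat set set" where
  "leader_sets n m = {S. S \<subseteq> {..<n} \<and> card S = m}"

definition optimal_noise_free_leaders :: "real mat \<Rightarrow> real \<Rightarrow> nat \<Rightarrow> nat set \<Rightarrow> bool" where
  "optimal_noise_free_leaders A \<sigma> m S \<longleftrightarrow>
     is_arg_min (noise_free_error A \<sigma>) (\<lambda>T. T \<in> leader_sets (dim_row A) m) S"


definition kirchhoff_index :: "real mat \<Rightarrow> real" where
  "kirchhoff_index A = real (dim_row A) * mat_trace (pseudoinverse (laplacian A))"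

definition biharmonic_matrix :: "real mat \<Rightarrow> real mat" where
  "biharmonic_matrix A =
     (let P = pseudoinverse (laplacian A * laplacian A)
      in mat (dim_row A) (dim_row A)
           (\<lambda>(i, j). P $$ (i, i) + P $$ (j, j) - 2 * P $$ (i, j)))"

text \<open>
  The principal submatrix whose rows and columns are taken in the order given by a list of
  indices (unlike \<open>submatrix\<close>, which always takes them in increasing order).
\<close>

definition principal_submatrix :: "'a mat \<Rightarrow> nat list \<Rightarrow> 'a mat" where
  "principal_submatrix B is =
     mat (length is) (length is) (\<lambda>(a, b). B $$ (is ! a, is ! b))"

definition other_leaders :: "nat set \<Rightarrow> nat \<Rightarrow> nat list" where
  "other_leaders S l = sorted_list_of_set (S - {l})"

text \<open>
  \<open>Ninv\<close> denotes the matrix written \<open>N\<^sup>-\<^sup>1\<close>. It is defined by its entries and is itself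
  singular: its row and column \<open>l\<close> vanish.
\<close>

definition Ninv :: "real mat \<Rightarrow> nat \<Rightarrow> real mat" where
  "Ninv A l =
     (let P = pseudoinverse (laplacian A)
      in mat (dim_row A) (dim_row A)
           (\<lambda>(i, j). P $$ (i, j) - P $$ (i, l) - P $$ (j, l) + P $$ (l, l)))"

definition G_matrix :: "real mat \<Rightarrow> nat set \<Rightarrow> nat \<Rightarrow> real mat" where
  "G_matrix A S l = the (mat_inverse (principal_submatrix (Ninv A l) (other_leaders S l)))"

definition G_bar :: "real mat \<Rightarrow> nat set \<Rightarrow> nat \<Rightarrow> real mat" where
  "G_bar A S l =
     four_block_mat (0\<^sub>m 1 1) (0\<^sub>m 1 (card S - 1)) (0\<^sub>m (card S - 1) 1) (G_matrix A S l)"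

definition Q_matrix :: "real mat \<Rightarrow> nat set \<Rightarrow> nat \<Rightarrow> real mat" where
  "Q_matrix A S l =
     G_bar A S l * principal_submatrix (biharmonic_matrix A) (l # other_leaders S l)"

definition joint_centrality :: "real mat \<Rightarrow> nat set \<Rightarrow> nat \<Rightarrow> real" where
  "joint_centrality A S l =
     (let n = real (dim_row A);
          L\<^sub>S = principal_submatrix (pseudoinverse (laplacian A)) (l # other_leaders S l);
          Q = Q_matrix A S l;
          ones = vec (card S) (\<lambda>_. 1);
          e\<^sub>l = unit_vec (card S) 0
      in n * inverse (kirchhoff_index A / n
                      + n * det (G_matrix A S l) * det L\<^sub>S
                      + 1 / 2 * mat_trace Q
                      - ones \<bullet> (Q *\<^sub>v e\<^sub>l)))"

end

theory Submission
  imports Defs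
begin

text \<open>
  The Lyapunov equation of the dynamics is solved by \<open>\<sigma>\<^sup>2 / 2\<close> times the inverse of \<open>M = L + K\<close>
  (\<open>steady_state_covariance_eq\<close>), so the total error is a multiple of the trace of that inverse. When
  the gain grows, the leaders are forced to zero, and the inverse tends to the matrix \<open>H\<close> that
  inverts \<open>L\<close> on the followers and is zero on the leaders (\<open>noise_free_limit\<close>).

  What remains is to express the trace of \<open>H\<close> through \<open>L\<^sup>+\<close>. In the language of electrical networks,
  \<open>H\<close> is the potential response when all leaders are grounded. Grounding the single node \<open>l\<close> merely
  shifts potentials and gives the matrix \<open>N\<close>, whose entries are those written \<open>N\<^sup>-\<^sup>1\<close> in the joint
  centrality. Grounding the other leaders subtracts a Schur-complement correction, built from the
  columns of \<open>N\<close> at those leaders and the inverse \<open>G\<close> of their block (\<open>H_leader_row\<close>,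
  \<open>L_H_follower_row\<close>). By cyclicity, the trace of the correction pairs \<open>G\<close> with the leader block of
  \<open>N\<^sup>2\<close>.

  The entries of \<open>N\<^sup>2\<close> have two parts (\<open>N_squared\<close>). One consists of biharmonic distances, by the law
  of cosines, and yields the two terms with \<open>Q\<close>. The other is a product of differences of entries of
  \<open>L\<^sup>+\<close>. The trace of \<open>N\<close> is that of \<open>L\<^sup>+\<close>, i.e. the Kirchhoff term, plus \<open>n\<close> times the entry of
  \<open>L\<^sup>+\<close> at \<open>(l, l)\<close>; this entry and the products combine to a Schur complement, which is the product
  of the two determinants (\<open>det_leader_block\<close>). Hence the trace of \<open>H\<close> is \<open>n / \<rho>\<close>
  (\<open>joint_centrality_eq\<close>). Since there is a follower, this trace is positive
  (\<open>grounded_trace_positive\<close>), so the error decreases strictly in \<open>\<rho>\<close> and minimizing the one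
  means maximizing the other.
\<close>

section \<open>Pseudoinverses, positive definite matrices and the Lyapunov equation\<close>

text \<open>
  The products \<open>B X\<close> and \<open>B Y\<close> are symmetric idempotents with the range of \<open>B\<close>, hence they
  agree; likewise \<open>X B = Y B\<close>. A pseudoinverse is recovered from these two projections, since
  \<open>X = X B X = Y B X = Y B Y = Y\<close>.
\<close>
lemma pseudoinverse_unique:
  assumes X: "is_pseudoinverse B X" and Y: "is_pseudoinverse B Y"
  shows "X = Y"
proof -
  define r c where "r = dim_row B" and "c = dim_col B"
  have B: "B \<in> carrier_mat r c" by (simp add: r_def c_def)
  have Xc: "X \<in> carrier_mat c r" and Yc: "Y \<in> carrier_mat c r"
    using X Y by (auto simp: is_pseudoinverse_def r_def c_def)
  have "B * X = transpose_mat (B * Y * (B * X))"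
  proof -
    have "B * Y * (B * X) = (B * Y * B) * X"
      using B Xc Yc by (simp add: assoc_mult_mat[of _ r c _ r _ r] assoc_mult_mat[of _ r c _ c _ r]
          assoc_mult_mat[of _ c r _ c _ r])
    then show ?thesis using X Y by (simp add: is_pseudoinverse_def)
  qed
  also have "\<dots> = B * X * (B * Y)"
    using B Xc Yc X Y by (subst transpose_mult[of _ r r _ r]) (auto simp: is_pseudoinverse_def)
  also have "\<dots> = (B * X * B) * Y"
    using B Xc Yc by (simp add: assoc_mult_mat[of _ r c _ r _ r] assoc_mult_mat[of _ r c _ c _ r]
        assoc_mult_mat[of _ c r _ c _ r])
  also have "\<dots> = B * Y" using X by (simp add: is_pseudoinverse_def)
  finally have range: "B * X = B * Y" .
  have "X * B = transpose_mat (X * B * (Y * B))"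
  proof -
    have "X * B * (Y * B) = X * (B * Y * B)"
      using B Xc Yc by (simp add: assoc_mult_mat[of _ c r _ c _ c] assoc_mult_mat[of _ r c _ r _ c])
    then show ?thesis using X Y by (simp add: is_pseudoinverse_def)
  qed
  also have "\<dots> = Y * B * (X * B)"
    using B Xc Yc X Y by (subst transpose_mult[of _ c c _ c]) (auto simp: is_pseudoinverse_def)
  also have "\<dots> = Y * (B * X * B)"
    using B Xc Yc by (simp add: assoc_mult_mat[of _ c r _ c _ c] assoc_mult_mat[of _ r c _ r _ c])
  also have "\<dots> = Y * B" using X by (simp add: is_pseudoinverse_def)
  finally have corange: "X * B = Y * B" .
  have "X = X * B * X" using X by (simp add: is_pseudoinverse_def)
  also have "\<dots> = Y * (B * X)"
    using B Xc Yc corange by (simp add: assoc_mult_mat[of _ c r _ c _ r])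
  also have "\<dots> = Y * B * Y"
    using B Xc Yc range by (simp add: assoc_mult_mat[of _ c r _ c _ r])
  also have "\<dots> = Y" using Y by (simp add: is_pseudoinverse_def)
  finally show ?thesis .
qed

lemma pseudoinverse_eqI: "is_pseudoinverse B X \<Longrightarrow> pseudoinverse B = X"
  unfolding pseudoinverse_def by (blast intro: pseudoinverse_unique)

lemma mat_inverse_of_injective:
  fixes M :: "real mat"
  assumes M: "M \<in> carrier_mat n n"
    and inj: "\<And>x. x \<in> carrier_vec n \<Longrightarrow> M *\<^sub>v x = 0\<^sub>v n \<Longrightarrow> x = 0\<^sub>v n"
  obtains E where "mat_inverse M = Some E" "E \<in> carrier_mat n n" "M * E = 1\<^sub>m n" "E * M = 1\<^sub>m n"
proof -
  have "det M \<noteq> 0" using det_0_iff_vec_prod_zero_field[OF M] inj by blast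
  then have "M \<in> Units (ring_mat TYPE(real) n ())" by (rule det_non_zero_imp_unit[OF M])
  then obtain E where "mat_inverse M = Some E"
    using mat_inverse(1)[OF M, where b = "()"] by (cases "mat_inverse M") auto
  with mat_inverse(2)[OF M this] show ?thesis using that by blast
qed

definition positive_definite :: "nat \<Rightarrow> real mat \<Rightarrow> bool" where
  "positive_definite n M \<longleftrightarrow>
     (\<forall>x \<in> carrier_vec n. x \<noteq> 0\<^sub>v n \<longrightarrow> 0 < x \<bullet> (M *\<^sub>v x))"

lemma positive_definite_inverse:
  assumes M: "M \<in> carrier_mat n n" and pd: "positive_definite n M"
  obtains E where "E \<in> carrier_mat n n" "M * E = 1\<^sub>m n" "E * M = 1\<^sub>m n"
proof -
  have inj: "x = 0\<^sub>v n" if "x \<in> carrier_vec n" "M *\<^sub>v x = 0\<^sub>v n" for x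
  proof (rule ccontr)
    assume "x \<noteq> 0\<^sub>v n"
    then have "0 < x \<bullet> (M *\<^sub>v x)" using pd that by (auto simp: positive_definite_def)
    then show False using that by simp
  qed
  show ?thesis by (rule mat_inverse_of_injective[OF M inj]) (use that in blast)+
qed

lemma inverse_symmetric:
  fixes M :: "'a :: comm_ring_1 mat"
  assumes M: "M \<in> carrier_mat n n" "transpose_mat M = M"
    and E: "E \<in> carrier_mat n n" "M * E = 1\<^sub>m n" "E * M = 1\<^sub>m n"
  shows "transpose_mat E = E"
proof -
  have "transpose_mat E = transpose_mat E * (M * E)" using E by simp
  also have "\<dots> = transpose_mat (M * E) * E"
    using M E by (subst transpose_mult[of _ n n _ n]) (auto simp: assoc_mult_mat[of _ n n _ n _ n])
  also have "\<dots> = E" using E by simp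
  finally show ?thesis .
qed

lemma mat_trace_comm:
  assumes "B \<in> carrier_mat r c" "C \<in> carrier_mat c r"
  shows "mat_trace (B * C) = mat_trace (C * B)"
proof -
  have "mat_trace (B * C) = (\<Sum>i<r. \<Sum>j<c. B $$ (i, j) * C $$ (j, i))"
    using assms by (auto simp: mat_trace_def scalar_prod_def atLeast0LessThan)
  also have "\<dots> = (\<Sum>j<c. \<Sum>i<r. C $$ (j, i) * B $$ (i, j))"
    by (subst sum.swap) (simp add: mult.commute)
  also have "\<dots> = mat_trace (C * B)"
    using assms by (auto simp: mat_trace_def scalar_prod_def atLeast0LessThan)
  finally show ?thesis .
qed

lemma mat_trace_add:
  assumes "B \<in> carrier_mat n n" "C \<in> carrier_mat n n"
  shows "mat_trace (B + C) = mat_trace B + mat_trace C"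
  using assms by (auto simp: mat_trace_def sum.distrib)

lemma mat_trace_minus:
  assumes "B \<in> carrier_mat n n" "C \<in> carrier_mat n n"
  shows "mat_trace (B - C) = mat_trace B - mat_trace C"
  using assms by (auto simp: mat_trace_def sum_subtractf)

lemma mat_trace_congruence:
  assumes "M \<in> carrier_mat n n" "Y \<in> carrier_mat n n"
  shows "mat_trace (transpose_mat Y * (M * Y)) = (\<Sum>i<n. col Y i \<bullet> (M *\<^sub>v col Y i))"
proof -
  have "(transpose_mat Y * (M * Y)) $$ (i, i) = col Y i \<bullet> (M *\<^sub>v col Y i)" if "i < n" for i
    using that assms by (simp add: col_mult2[of _ n n _ n])
  then show ?thesis using assms by (auto simp: mat_trace_def)
qed

text \<open>
  The trace of \<open>Y\<^sup>T (M Y + Y M)\<close> is the sum of the values of the quadratic form of \<open>M\<close> on all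
  columns and all rows of \<open>Y\<close>. If it vanishes, positive definiteness kills every column.
\<close>
lemma lyapunov_kernel_trivial:
  assumes M: "M \<in> carrier_mat n n" and pd: "positive_definite n M"
    and Y: "Y \<in> carrier_mat n n" and zero: "M * Y + Y * M = 0\<^sub>m n n"
  shows "Y = 0\<^sub>m n n"
proof -
  have nonneg: "0 \<le> x \<bullet> (M *\<^sub>v x)" if "x \<in> carrier_vec n" for x
    using pd that M by (cases "x = 0\<^sub>v n") (auto simp: positive_definite_def less_imp_le)
  have "0 = mat_trace (transpose_mat Y * (M * Y + Y * M))"
    using Y by (simp add: zero mat_trace_def)
  also have "\<dots> = mat_trace (transpose_mat Y * (M * Y)) + mat_trace (transpose_mat Y * (Y * M))"
    using M Y by (subst mult_add_distrib_mat[of _ n n _ n]) (auto intro!: mat_trace_add[of _ n])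
  also have "mat_trace (transpose_mat Y * (Y * M)) =
      mat_trace (transpose_mat (transpose_mat Y) * (M * transpose_mat Y))"
    using M Y by (subst mat_trace_comm[of _ n n]) (auto simp: assoc_mult_mat[of _ n n _ n _ n])
  also have "mat_trace (transpose_mat Y * (M * Y)) = (\<Sum>i<n. col Y i \<bullet> (M *\<^sub>v col Y i))"
    by (rule mat_trace_congruence[OF M Y])
  also have "mat_trace (transpose_mat (transpose_mat Y) * (M * transpose_mat Y)) =
      (\<Sum>i<n. col (transpose_mat Y) i \<bullet> (M *\<^sub>v col (transpose_mat Y) i))"
    using Y by (intro mat_trace_congruence[OF M]) auto
  finally have sum0: "(\<Sum>i<n. col Y i \<bullet> (M *\<^sub>v col Y i)) +
      (\<Sum>i<n. col (transpose_mat Y) i \<bullet> (M *\<^sub>v col (transpose_mat Y) i)) = 0" by simp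
  have "(\<Sum>i<n. col (transpose_mat Y) i \<bullet> (M *\<^sub>v col (transpose_mat Y) i)) \<ge> 0"
    "(\<Sum>i<n. col Y i \<bullet> (M *\<^sub>v col Y i)) \<ge> 0"
    using Y by (auto intro!: sum_nonneg nonneg)
  with sum0 have "(\<Sum>i<n. col Y i \<bullet> (M *\<^sub>v col Y i)) = 0" by linarith
  then have "col Y i \<bullet> (M *\<^sub>v col Y i) = 0" if "i < n" for i
    using that Y by (subst (asm) sum_nonneg_eq_0_iff) (auto intro!: nonneg)
  then have "col Y i = 0\<^sub>v n" if "i < n" for i
    using pd that Y by (metis positive_definite_def less_irrefl col_carrier_vec)
  then show ?thesis using Y
    by (intro mat_col_eqI) auto
qed

text \<open>
  Because \<open>M\<close> is symmetric, a multiple of its inverse solves the Lyapunov equation at sight. That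
  it is the only solution is what makes the definite description in the definition of the covariance
  meaningful.
\<close>
lemma steady_state_covariance_eq:
  assumes M: "M \<in> carrier_mat n n" "transpose_mat M = M" and pd: "positive_definite n M"
    and E: "E \<in> carrier_mat n n" "M * E = 1\<^sub>m n" "E * M = 1\<^sub>m n"
  shows "steady_state_covariance M \<sigma> = (\<sigma>\<^sup>2 / 2) \<cdot>\<^sub>m E"
  unfolding steady_state_covariance_def
proof (rule the_equality)
  let ?X = "(\<sigma>\<^sup>2 / 2) \<cdot>\<^sub>m E"
  have solves: "M * ?X + ?X * transpose_mat M = \<sigma>\<^sup>2 \<cdot>\<^sub>m 1\<^sub>m n"
    using M E by (simp add: mult_smult_distrib[of _ n n _ n] mult_smult_assoc_mat[of _ n n _ n]
        flip: add_smult_distrib_right_mat[of _ n n])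
  then show "?X \<in> carrier_mat (dim_row M) (dim_row M) \<and>
      M * ?X + ?X * transpose_mat M = \<sigma>\<^sup>2 \<cdot>\<^sub>m 1\<^sub>m (dim_row M)" using M E by auto
  fix X assume X: "X \<in> carrier_mat (dim_row M) (dim_row M) \<and>
      M * X + X * transpose_mat M = \<sigma>\<^sup>2 \<cdot>\<^sub>m 1\<^sub>m (dim_row M)"
  then have Xc: "X \<in> carrier_mat n n" and Xs: "M * X + X * M = \<sigma>\<^sup>2 \<cdot>\<^sub>m 1\<^sub>m n"
    using M by auto
  have "M * (X - ?X) + (X - ?X) * M = (M * X + X * M) - (M * ?X + ?X * M)"
    using M Xc E by (subst mult_minus_distrib_mat[of _ n n _ n], simp_all,
        subst minus_mult_distrib_mat[of _ n n _ _ n], simp_all) (intro eq_matI, auto)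
  also have "\<dots> = 0\<^sub>m n n" using Xs solves M by (auto intro!: eq_matI)
  finally have "X - ?X = 0\<^sub>m n n"
    using lyapunov_kernel_trivial[OF M(1) pd] Xc E by (metis minus_carrier_mat smult_carrier_mat)
  then have "X $$ (i, j) = ?X $$ (i, j)" if "i < n" "j < n" for i j
    using that Xc E
    by (metis carrier_matD index_minus_mat(1) index_smult_mat(2,3) index_zero_mat(1) right_minus_eq)
  then show "X = ?X" using Xc E by (intro eq_matI) auto
qed

section \<open>The pseudoinverse of a connected Laplacian\<close>

text \<open>
  The spectral content of connectivity: a positive semidefinite matrix whose null vectors are
  exactly the constant ones. Edges and weights enter the argument only through these properties.
\<close>
locale connected_laplacian =
  fixes n :: nat and L :: "real mat"
  assumes L_carrier [simp]: "L \<in> carrier_mat n n"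
    and L_sym: "transpose_mat L = L"
    and L_ones: "\<And>i. i < n \<Longrightarrow> (\<Sum>j<n. L $$ (i, j)) = 0"
    and L_nonneg: "\<And>x. x \<in> carrier_vec n \<Longrightarrow> 0 \<le> x \<bullet> (L *\<^sub>v x)"
    and L_kernel: "\<And>x i j. \<lbrakk>x \<in> carrier_vec n; x \<bullet> (L *\<^sub>v x) = 0; i < n; j < n\<rbrakk> \<Longrightarrow> x $ i = x $ j"
    and n_pos: "0 < n"
begin

text \<open>
  The orthogonal projection onto the constant vectors, i.e. onto the kernel of \<open>L\<close>.
\<close>
definition average :: "real mat" where
  "average = mat n n (\<lambda>_. 1 / real n)"

abbreviation P :: "real mat" where "P \<equiv> pseudoinverse L"

lemma average_carrier [simp]: "average \<in> carrier_mat n n"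
  by (simp add: average_def)

lemma L_dim [simp]: "dim_row L = n" "dim_col L = n"
  using carrier_matD[OF L_carrier] .

lemmas square_carrier [simp] = mult_carrier_mat[of _ n n _ n] mult_mat_vec_carrier[of _ n n]

lemma average_dim [simp]: "dim_row average = n" "dim_col average = n"
  by (simp_all add: average_def)

lemma average_sym: "transpose_mat average = average"
  by (auto simp: average_def)

lemma average_idem: "average * average = average"
  using n_pos by (auto simp: average_def scalar_prod_def intro!: eq_matI)

lemma L_average: "L * average = 0\<^sub>m n n"
proof (rule eq_matI)
  fix i j assume "i < dim_row (0\<^sub>m n n :: real mat)" "j < dim_col (0\<^sub>m n n :: real mat)"
  then have ij: "i < n" "j < n" by auto
  then have "(L * average) $$ (i, j) = (\<Sum>q<n. L $$ (i, q) / real n)"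
    by (auto simp: average_def scalar_prod_def atLeast0LessThan)
  also have "\<dots> = 0" using L_ones[OF ij(1)] by (simp flip: sum_divide_distrib)
  finally show "(L * average) $$ (i, j) = (0\<^sub>m n n :: real mat) $$ (i, j)" using ij by simp
qed (use L_carrier in \<open>auto simp: average_def\<close>)

lemma average_L: "average * L = 0\<^sub>m n n"
proof -
  have "average * L = transpose_mat (L * average)"
    by (subst transpose_mult[of _ n n _ n]) (simp_all add: L_sym average_sym)
  then show ?thesis by (simp add: L_average)
qed

lemma positive_definite_average: "positive_definite n (L + average)"
  unfolding positive_definite_def
proof (intro ballI impI)
  fix x :: "real vec" assume x: "x \<in> carrier_vec n" and "x \<noteq> 0\<^sub>v n"
  define s where "s = (\<Sum>j<n. x $ j)"
  have avg: "x \<bullet> (average *\<^sub>v x) = s\<^sup>2 / real n"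
  proof -
    have "average *\<^sub>v x = vec n (\<lambda>_. s / real n)"
      using x by (intro eq_vecI)
        (auto simp: average_def scalar_prod_def s_def atLeast0LessThan sum_divide_distrib)
    then show ?thesis using x
      by (simp add: scalar_prod_def atLeast0LessThan s_def power2_eq_square
          flip: sum_distrib_right sum_divide_distrib)
  qed
  have split: "x \<bullet> ((L + average) *\<^sub>v x) = x \<bullet> (L *\<^sub>v x) + s\<^sup>2 / real n"
    using x by (simp add: add_mult_distrib_mat_vec[of _ n n] scalar_prod_add_distrib[of _ n] flip: avg)
  have s_nonneg: "0 \<le> s\<^sup>2 / real n" by simp
  have "x \<bullet> ((L + average) *\<^sub>v x) \<noteq> 0"
  proof
    assume "x \<bullet> ((L + average) *\<^sub>v x) = 0"
    with split L_nonneg[OF x] s_nonneg have "x \<bullet> (L *\<^sub>v x) = 0" "s\<^sup>2 / real n = 0"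
      by linarith+
    then have const: "x $ i = x $ 0" if "i < n" for i
      using L_kernel[OF x _ that n_pos] by blast
    have "s = 0" using \<open>s\<^sup>2 / real n = 0\<close> n_pos by simp
    have "s = (\<Sum>j<n. x $ 0)" unfolding s_def by (rule sum.cong[OF refl]) (use const in blast)
    with \<open>s = 0\<close> have "x $ 0 = 0" using n_pos by simp
    then have "x $ i = 0" if "i < n" for i using const[OF that] by simp
    then have "x = 0\<^sub>v n" using x by (intro eq_vecI) auto
    with \<open>x \<noteq> 0\<^sub>v n\<close> show False ..
  qed
  then show "0 < x \<bullet> ((L + average) *\<^sub>v x)"
    using split L_nonneg[OF x] s_nonneg by linarith
qed

text \<open>
  Adding the projection onto its kernel makes \<open>L\<close> invertible without disturbing it on the
  orthogonal complement, so the pseudoinverse is the inverse of \<open>L + average\<close> with that projection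
  removed again.
\<close>
lemma complementary_inverse_exists:
  obtains X where "X \<in> carrier_mat n n" "transpose_mat X = X" "L * X = 1\<^sub>m n - average"
    "X * L = 1\<^sub>m n - average" "average * X = 0\<^sub>m n n"
proof -
  let ?B = "L + average"
  have B: "?B \<in> carrier_mat n n" "transpose_mat ?B = ?B"
    by (auto simp: transpose_add[of _ n n] L_sym average_sym)
  obtain R where R: "R \<in> carrier_mat n n" "?B * R = 1\<^sub>m n" "R * ?B = 1\<^sub>m n"
    using positive_definite_inverse[OF B(1) positive_definite_average] by blast
  have R_sym: "transpose_mat R = R" by (rule inverse_symmetric[OF B R])
  have "?B * average = average"
    by (simp add: add_mult_distrib_mat[of _ n n _ _ n] L_average average_idem)
  then have "R * average = R * (?B * average)" by simp
  also have "\<dots> = average" using R B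
    by (simp add: left_mult_one_mat[of _ n n] del: assoc_mult_mat flip: assoc_mult_mat[of _ n n _ n _ n])
  finally have R_avg: "R * average = average" .
  have avg_R: "average * R = average"
    using arg_cong[OF R_avg, of transpose_mat] R
    by (simp add: transpose_mult[of _ n n _ n] R_sym average_sym)
  have LR: "L * R = 1\<^sub>m n - average"
  proof -
    have "L * R + average = 1\<^sub>m n"
      using R avg_R by (simp add: add_mult_distrib_mat[of _ n n _ _ n])
    moreover have "L * R = L * R + average - average" using R by (intro eq_matI) auto
    ultimately show ?thesis by simp
  qed
  have RL: "R * L = 1\<^sub>m n - average"
    using arg_cong[OF LR, of transpose_mat] R
    by (simp add: transpose_mult[of _ n n _ n] transpose_minus[of _ n n] R_sym L_sym average_sym)
  show ?thesis
  proof (rule that[of "R - average"])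
    show "transpose_mat (R - average) = R - average"
      using R by (simp add: transpose_minus[of _ n n] R_sym average_sym)
    show "L * (R - average) = 1\<^sub>m n - average"
      using R by (simp add: mult_minus_distrib_mat[of _ n n _ n] L_average LR) (auto simp: average_def)
    show "(R - average) * L = 1\<^sub>m n - average"
      using R by (simp add: minus_mult_distrib_mat[of _ n n _ _ n] average_L RL) (auto simp: average_def)
    show "average * (R - average) = 0\<^sub>m n n"
      using R by (simp add: mult_minus_distrib_mat[of _ n n _ n] average_idem avg_R)
  qed (use R in auto)
qed

text \<open>
  Such an \<open>X\<close> inverts \<open>L\<close> on the complement of the constants and vanishes on the constants.
  Both properties pass to the squares, which is why the biharmonic distance, defined through the
  pseudoinverse of \<open>L\<^sup>2\<close>, can be computed from the square of the pseudoinverse of \<open>L\<close>.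
\<close>
lemma pseudoinverse_of_complementary_inverse:
  assumes X: "X \<in> carrier_mat n n" "transpose_mat X = X" "L * X = 1\<^sub>m n - average"
    "X * L = 1\<^sub>m n - average" "average * X = 0\<^sub>m n n"
  shows "is_pseudoinverse L X" "is_pseudoinverse (L * L) (X * X)"
proof -
  have sym: "transpose_mat (1\<^sub>m n - average) = 1\<^sub>m n - average"
    by (simp add: transpose_minus[of _ n n] average_sym)
  have C: "1\<^sub>m n - average \<in> carrier_mat n n" by (rule minus_carrier_mat) simp
  have CL: "(1\<^sub>m n - average) * L = L"
    by (simp add: minus_mult_distrib_mat[of _ n n _ _ n] average_L)
       (use L_carrier in \<open>auto intro!: eq_matI simp del: L_carrier\<close>)
  have CX: "(1\<^sub>m n - average) * X = X"
    using X by (simp add: minus_mult_distrib_mat[of _ n n _ _ n]) (auto intro!: eq_matI)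
  show "is_pseudoinverse L X"
    using X L_carrier sym CL CX by (auto simp: is_pseudoinverse_def)
  have LLXX: "L * L * (X * X) = 1\<^sub>m n - average"
  proof -
    have "L * L * (X * X) = L * ((L * X) * X)"
      using X(1) by (simp add: assoc_mult_mat[of _ n n _ n _ n])
    then show ?thesis by (simp add: X(3) CX)
  qed
  have XXLL: "X * X * (L * L) = 1\<^sub>m n - average"
  proof -
    have "X * X * (L * L) = X * ((X * L) * L)"
      using X(1) by (simp add: assoc_mult_mat[of _ n n _ n _ n])
    then show ?thesis by (simp add: X(4) CL)
  qed
  have "(1\<^sub>m n - average) * (L * L) = L * L" "(1\<^sub>m n - average) * (X * X) = X * X"
    using CL CX C X(1) by (simp_all del: assoc_mult_mat flip: assoc_mult_mat[of _ n n _ n _ n])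
  then show "is_pseudoinverse (L * L) (X * X)"
    using X(1) L_carrier sym by (auto simp: is_pseudoinverse_def LLXX XXLL)
qed

lemma P_carrier [simp]: "P \<in> carrier_mat n n"
  and P_sym: "transpose_mat P = P"
  and L_P: "L * P = 1\<^sub>m n - average"
  and average_P: "average * P = 0\<^sub>m n n"
  and pseudoinverse_L_squared: "pseudoinverse (L * L) = P * P"
proof -
  obtain X where X: "X \<in> carrier_mat n n" "transpose_mat X = X" "L * X = 1\<^sub>m n - average"
    "X * L = 1\<^sub>m n - average" "average * X = 0\<^sub>m n n"
    by (rule complementary_inverse_exists)
  have P: "P = X" by (rule pseudoinverse_eqI[OF pseudoinverse_of_complementary_inverse(1)[OF X]])
  show "P \<in> carrier_mat n n" "transpose_mat P = P" "L * P = 1\<^sub>m n - average" "average * P = 0\<^sub>m n n"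
    by (simp_all add: P X)
  show "pseudoinverse (L * L) = P * P"
    unfolding P by (rule pseudoinverse_eqI[OF pseudoinverse_of_complementary_inverse(2)[OF X]])
qed

lemma P_dim [simp]: "dim_row P = n" "dim_col P = n"
  using P_carrier by (metis carrier_matD)+

lemma P_commute: "i < n \<Longrightarrow> j < n \<Longrightarrow> P $$ (i, j) = P $$ (j, i)"
  using P_sym P_carrier by (metis carrier_matD index_transpose_mat(1))

lemma P_column_sum:
  assumes "j < n" shows "(\<Sum>i<n. P $$ (i, j)) = 0"
proof -
  have "0 = (average * P) $$ (0, j)" using assms n_pos by (simp add: average_P)
  also have "\<dots> = (\<Sum>i<n. P $$ (i, j)) / real n"
    using assms n_pos
    by (auto simp: average_def scalar_prod_def atLeast0LessThan sum_divide_distrib)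
  finally show ?thesis using n_pos by simp
qed

lemma P_row_sum: "i < n \<Longrightarrow> (\<Sum>j<n. P $$ (i, j)) = 0"
  using P_column_sum[of i] by (simp add: P_commute)

end

section \<open>Principal submatrices as congruences\<close>

lemma index_mult_mat_sum:
  assumes "B \<in> carrier_mat r q" "C \<in> carrier_mat q c" "i < r" "j < c"
  shows "(B * C) $$ (i, j) = (\<Sum>k<q. B $$ (i, k) * C $$ (k, j))"
  using assms by (auto simp: scalar_prod_def atLeast0LessThan)

lemma mult_mat_row_zero:
  assumes "B \<in> carrier_mat r q" "C \<in> carrier_mat q c" "i < r" "j < c"
    and "\<And>k. k < q \<Longrightarrow> B $$ (i, k) = 0"
  shows "(B * C) $$ (i, j) = 0"
  using assms(5) by (simp add: index_mult_mat_sum[OF assms(1-4)])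

text \<open>
  The columns of this matrix are the unit vectors of the listed indices. Multiplying by it from the
  right selects columns, multiplying by its transpose from the left selects rows; this turns statements
  about principal submatrices into matrix algebra without index sets.
\<close>
definition selection :: "nat \<Rightarrow> nat list \<Rightarrow> real mat" where
  "selection n js = mat n (length js) (\<lambda>(i, a). if i = js ! a then 1 else 0)"

lemma selection_carrier [simp]: "selection n js \<in> carrier_mat n (length js)"
  by (simp add: selection_def)

lemma selection_dim [simp]:
  "dim_row (selection n js) = n" "dim_col (selection n js) = length js"
  by (simp_all add: selection_def)

lemma mult_selection:
  assumes "B \<in> carrier_mat r n" "set js \<subseteq> {..<n}" "i < r" "a < length js"
  shows "(B * selection n js) $$ (i, a) = B $$ (i, js ! a)"
proof -
  have "js ! a < n" using assms(2,4) nth_mem by blast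
  then have "(\<Sum>k<n. B $$ (i, k) * (if k = js ! a then 1 else 0)) = B $$ (i, js ! a)"
    by (simp add: if_distrib[of "\<lambda>x. _ * x"] sum.delta cong: if_cong)
  then show ?thesis
    using assms by (subst index_mult_mat_sum[of _ r n _ "length js"]) (auto simp: selection_def)
qed

lemma selection_mult:
  assumes "B \<in> carrier_mat n c" "set js \<subseteq> {..<n}" "a < length js" "j < c"
  shows "(transpose_mat (selection n js) * B) $$ (a, j) = B $$ (js ! a, j)"
proof -
  have "js ! a < n" using assms(2,3) nth_mem by blast
  then have "(\<Sum>k<n. (if k = js ! a then 1 else 0) * B $$ (k, j)) = B $$ (js ! a, j)"
    by (simp add: if_distrib[of "\<lambda>x. x * _"] sum.delta cong: if_cong)
  then show ?thesis
    using assms by (subst index_mult_mat_sum[of _ "length js" n _ c]) (auto simp: selection_def)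
qed

lemma principal_submatrix_eq_congruence:
  assumes "B \<in> carrier_mat n n" "set js \<subseteq> {..<n}"
  shows "principal_submatrix B js = transpose_mat (selection n js) * (B * selection n js)"
proof (rule eq_matI)
  fix a b
  assume "a < dim_row (transpose_mat (selection n js) * (B * selection n js))"
    and "b < dim_col (transpose_mat (selection n js) * (B * selection n js))"
  then have ab: "a < length js" "b < length js" by (auto simp: selection_def)
  moreover have "js ! a < n" using assms(2) ab(1) nth_mem by blast
  moreover have "B * selection n js \<in> carrier_mat n (length js)"
    by (rule mult_carrier_mat[OF assms(1)]) simp
  ultimately show "principal_submatrix B js $$ (a, b) =
      (transpose_mat (selection n js) * (B * selection n js)) $$ (a, b)"
    using assms
    by (simp add: principal_submatrix_def selection_mult[of _ n "length js"] mult_selection[of _ n]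
        del: index_mult_mat(1))
qed (auto simp: principal_submatrix_def selection_def)

section \<open>Grounding one node\<close>

context connected_laplacian
begin

text \<open>
  The inverse of \<open>L\<close> with row and column \<open>l\<close> deleted, padded with a zero row and column at \<open>l\<close>.
  It is \<open>L\<^sup>+\<close> with its potentials shifted so that node \<open>l\<close> has potential zero.
\<close>
definition grounded_inverse :: "nat \<Rightarrow> real mat" where
  "grounded_inverse l = mat n n (\<lambda>(i, j). P $$ (i, j) - P $$ (i, l) - P $$ (j, l) + P $$ (l, l))"

end

text \<open>
  The leader set is split into a distinguished leader \<open>l\<close> and the list \<open>js\<close> of the others. The list
  may be empty, which is the case of a single leader.
\<close>
locale leader_grounding = connected_laplacian +
  fixes l :: nat and js :: "nat list"
  assumes l_less: "l < n" and js_less: "set js \<subseteq> {..<n}" and js_distinct: "distinct js"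
    and l_notin: "l \<notin> set js"
begin

abbreviation N :: "real mat" where "N \<equiv> grounded_inverse l"
abbreviation E :: "real mat" where "E \<equiv> selection n js"
abbreviation p :: nat where "p \<equiv> length js"

lemma N_carrier [simp]: "N \<in> carrier_mat n n" and N_dim [simp]: "dim_row N = n" "dim_col N = n"
  by (simp_all add: grounded_inverse_def)

lemma N_sym: "transpose_mat N = N"
  by (rule eq_matI) (auto simp: grounded_inverse_def P_commute)

lemma N_commute: "i < n \<Longrightarrow> j < n \<Longrightarrow> N $$ (i, j) = N $$ (j, i)"
  by (simp add: grounded_inverse_def P_commute)

lemma N_row_l: "j < n \<Longrightarrow> N $$ (l, j) = 0"
  using l_less by (simp add: grounded_inverse_def P_commute)

text \<open>
  A unit current enters at \<open>j\<close> and leaves at the grounded node, so the product is the identity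
  except in row \<open>l\<close>.
\<close>
lemma L_N:
  assumes "i < n" "j < n"
  shows "(L * N) $$ (i, j) = (if i = j then 1 else 0) - (if i = l then 1 else 0)"
proof -
  have "(L * N) $$ (i, j) = (\<Sum>q<n. L $$ (i, q) * N $$ (q, j))"
    using assms by (simp add: index_mult_mat_sum[of _ n n _ n] del: index_mult_mat(1))
  also have "\<dots> = (\<Sum>q<n. L $$ (i, q) * P $$ (q, j)) - (\<Sum>q<n. L $$ (i, q) * P $$ (q, l))
      - (\<Sum>q<n. L $$ (i, q)) * P $$ (j, l) + (\<Sum>q<n. L $$ (i, q)) * P $$ (l, l)"
    using assms by (simp add: grounded_inverse_def algebra_simps sum.distrib sum_subtractf
        flip: sum_distrib_left sum_distrib_right)
  also have "\<dots> = (L * P) $$ (i, j) - (L * P) $$ (i, l)"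
    using assms l_less
    by (simp add: L_ones index_mult_mat_sum[of _ n n _ n] del: index_mult_mat(1))
  also have "\<dots> = (if i = j then 1 else 0) - (if i = l then 1 else 0)"
    using assms l_less by (simp add: L_P average_def)
  finally show ?thesis .
qed

lemma js_nth: "a < p \<Longrightarrow> js ! a < n" "a < p \<Longrightarrow> js ! a \<noteq> l"
  using js_less l_notin nth_mem by blast+

text \<open>
  If \<open>y\<close> is in the kernel, regard it as currents \<open>z\<close> injected at the nodes \<open>js\<close>, with potentials
  \<open>w = N z\<close>. The dissipated energy \<open>w \<bullet> L w\<close> equals \<open>w \<bullet> z\<close>, which vanishes because \<open>w\<close> vanishes
  on \<open>js\<close>. Hence \<open>w\<close> is constant, in fact zero as node \<open>l\<close> is grounded, and no current flows
  anywhere.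
\<close>
lemma leader_submatrix_injective:
  assumes y: "y \<in> carrier_vec p" and zero: "principal_submatrix N js *\<^sub>v y = 0\<^sub>v p"
  shows "y = 0\<^sub>v p"
proof -
  define z where "z = E *\<^sub>v y"
  define w where "w = N *\<^sub>v z"
  have z: "z \<in> carrier_vec n"
    unfolding z_def by (rule mult_mat_vec_carrier[OF selection_carrier y])
  have w: "w \<in> carrier_vec n" using z by (simp add: w_def)
  have z_nth: "z $ i = (\<Sum>a<p. if i = js ! a then y $ a else 0)" if "i < n" for i
    using that y by (auto simp: z_def selection_def scalar_prod_def atLeast0LessThan intro!: sum.cong)
  have z_l: "z $ l = 0" using l_less by (auto simp: z_nth js_nth(2)[symmetric] intro!: sum.neutral)
  have z_js: "z $ (js ! a) = y $ a" if "a < p" for a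
    using that js_nth(1)[OF that] js_distinct
    by (simp add: z_nth nth_eq_iff_index_eq sum.delta' cong: if_cong)
  have w_l: "w $ l = 0"
    using z l_less by (auto simp: w_def scalar_prod_def N_row_l intro!: sum.neutral)
  have Etw: "transpose_mat E *\<^sub>v w = 0\<^sub>v p"
  proof -
    have Et: "transpose_mat E \<in> carrier_mat p n" by simp
    have NE: "N * E \<in> carrier_mat n p" by (rule mult_carrier_mat[OF N_carrier selection_carrier])
    have "principal_submatrix N js *\<^sub>v y = transpose_mat E *\<^sub>v ((N * E) *\<^sub>v y)"
      unfolding principal_submatrix_eq_congruence[OF N_carrier js_less]
      by (rule assoc_mult_mat_vec[OF Et NE y])
    also have "(N * E) *\<^sub>v y = w"
      unfolding w_def z_def by (rule assoc_mult_mat_vec[OF N_carrier selection_carrier y])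
    finally have "transpose_mat E *\<^sub>v w = principal_submatrix N js *\<^sub>v y" ..
    then show ?thesis by (simp add: zero)
  qed
  have w_z: "w \<bullet> z = 0"
  proof -
    have "w \<bullet> z = (transpose_mat E *\<^sub>v w) \<bullet> y"
      unfolding z_def by (rule transpose_vec_mult_scalar[OF selection_carrier y w, symmetric])
    then show ?thesis using y by (simp add: Etw)
  qed
  have Lw: "(L *\<^sub>v w) $ i = z $ i - (if i = l then (\<Sum>q<n. z $ q) else 0)" if "i < n" for i
  proof -
    have "L *\<^sub>v w = (L * N) *\<^sub>v z" unfolding w_def
      by (rule assoc_mult_mat_vec[OF L_carrier N_carrier z, symmetric])
    then have "(L *\<^sub>v w) $ i = (\<Sum>q<n. (L * N) $$ (i, q) * z $ q)"
      using z that by (simp add: scalar_prod_def atLeast0LessThan)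
    also have "\<dots> = (\<Sum>q<n. (if i = q then z $ q else 0) - (if i = l then z $ q else 0))"
      using that by (intro sum.cong) (auto simp: L_N simp del: index_mult_mat(1))
    also have "\<dots> = z $ i - (if i = l then (\<Sum>q<n. z $ q) else 0)"
      using that by (simp add: sum_subtractf)
    finally show ?thesis .
  qed
  have "w \<bullet> (L *\<^sub>v w) = (\<Sum>i<n. w $ i * (z $ i - (if i = l then (\<Sum>q<n. z $ q) else 0)))"
    using Lw by (simp add: scalar_prod_def atLeast0LessThan)
  also have "\<dots> = w \<bullet> z - (\<Sum>i<n. if i = l then w $ i * (\<Sum>q<n. z $ q) else 0)"
    using carrier_vecD[OF z]
    by (simp add: scalar_prod_def atLeast0LessThan right_diff_distrib sum_subtractf
        if_distrib[of "\<lambda>x. _ * x"] cong: if_cong)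
  also have "\<dots> = 0" using l_less by (simp add: w_z w_l)
  finally have "w \<bullet> (L *\<^sub>v w) = 0" .
  then have "w $ i = 0" if "i < n" for i
    using L_kernel[OF w _ that l_less] w_l by simp
  then have "(L *\<^sub>v w) $ i = 0" if "i < n" for i
    using that w by (auto simp: scalar_prod_def intro!: sum.neutral)
  then have "z $ i = 0" if "i < n" "i \<noteq> l" for i
    using Lw[OF that(1)] that by simp
  then have "y $ a = 0" if "a < p" for a
    using z_js[OF that] js_nth[OF that] by metis
  then show ?thesis using y by (intro eq_vecI) auto
qed

end

section \<open>Grounding all leaders\<close>

lemma symmetric_congruence:
  fixes C G :: "real mat"
  assumes C: "C \<in> carrier_mat n p" and G: "G \<in> carrier_mat p p" "transpose_mat G = G"
  shows "transpose_mat (C * (G * transpose_mat C)) = C * (G * transpose_mat C)"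
proof -
  have "G * transpose_mat C \<in> carrier_mat p n" using C G by (intro mult_carrier_mat[of _ p p]) auto
  then have "transpose_mat (C * (G * transpose_mat C)) = transpose_mat (G * transpose_mat C) * transpose_mat C"
    by (rule transpose_mult[OF C])
  also have "transpose_mat (G * transpose_mat C) = C * G"
    using C G by (subst transpose_mult[of _ p p _ n]) auto
  finally show ?thesis using C G by (simp add: assoc_mult_mat[of _ n p _ p _ n])
qed

context leader_grounding
begin

text \<open>
  The inverse of the block of \<open>N\<close> that belongs to the remaining leaders, written \<open>G\<close> in the
  joint centrality.
\<close>
definition Gm :: "real mat" where
  "Gm = the (mat_inverse (principal_submatrix N js))"

lemma Nsub_carrier [simp]: "principal_submatrix N js \<in> carrier_mat p p"
  by (simp add: principal_submatrix_def)

lemma Gm: "Gm \<in> carrier_mat p p" "principal_submatrix N js * Gm = 1\<^sub>m p"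
    "Gm * principal_submatrix N js = 1\<^sub>m p"
  using mat_inverse_of_injective[OF Nsub_carrier leader_submatrix_injective]
  by (metis Gm_def option.sel)+

lemma Nsub_sym: "transpose_mat (principal_submatrix N js) = principal_submatrix N js"
  by (rule eq_matI) (auto simp: principal_submatrix_def N_commute js_nth)

lemma Gm_sym: "transpose_mat Gm = Gm"
  by (rule inverse_symmetric[OF Nsub_carrier Nsub_sym Gm])

abbreviation C :: "real mat" where "C \<equiv> N * E"

lemma C_carrier [simp]: "C \<in> carrier_mat n p"
  by (rule mult_carrier_mat[OF N_carrier selection_carrier])

lemma C_nth: "i < n \<Longrightarrow> a < p \<Longrightarrow> C $$ (i, a) = N $$ (i, js ! a)"
  by (rule mult_selection[OF N_carrier js_less])

lemma C_transpose: "transpose_mat C = transpose_mat E * N"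
  by (subst transpose_mult[of _ n n _ p]) (simp_all add: N_sym)

text \<open>
  Grounding the nodes \<open>js\<close> in addition to \<open>l\<close>. The subtracted term is the Schur-complement
  correction that makes the potentials of these nodes vanish too, so \<open>H\<close> is the inverse of \<open>L\<close> with all
  leader rows and columns deleted, padded with zeros.
\<close>
definition H :: "real mat" where
  "H = N - C * (Gm * transpose_mat C)"

lemma correction_carrier: "Gm * transpose_mat C \<in> carrier_mat p n"
    "C * (Gm * transpose_mat C) \<in> carrier_mat n n"
proof -
  show 1: "Gm * transpose_mat C \<in> carrier_mat p n"
    using Gm(1) by (intro mult_carrier_mat[of _ p p]) simp_all
  show "C * (Gm * transpose_mat C) \<in> carrier_mat n n"
    by (rule mult_carrier_mat[OF C_carrier 1])
qed

lemma H_carrier [simp]: "H \<in> carrier_mat n n"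
  unfolding H_def by (rule minus_carrier_mat[OF correction_carrier(2)])

lemma H_sym: "transpose_mat H = H"
  unfolding H_def
  by (subst transpose_minus[OF N_carrier correction_carrier(2)])
     (simp only: N_sym symmetric_congruence[OF C_carrier Gm(1) Gm_sym])

lemma H_leader_row:
  assumes s: "s \<in> set (l # js)" and j: "j < n"
  shows "H $$ (s, j) = 0"
proof (cases "s = l")
  case True
  have "(C * (Gm * transpose_mat C)) $$ (l, j) = 0"
    by (rule mult_mat_row_zero[OF C_carrier correction_carrier(1) l_less j])
       (simp add: C_nth l_less N_row_l js_nth del: index_mult_mat(1))
  moreover have "H $$ (l, j) = N $$ (l, j) - (C * (Gm * transpose_mat C)) $$ (l, j)"
    unfolding H_def using l_less j correction_carrier(2)
    by (intro index_minus_mat(1)) auto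
  ultimately show ?thesis using True j by (simp add: N_row_l)
next
  case False
  then obtain a where a: "a < p" "s = js ! a" using s by (auto simp: in_set_conv_nth)
  have Et: "transpose_mat E \<in> carrier_mat p n" by simp
  (* selecting the leader rows of the correction reproduces those of N, as G inverts their block *)
  have "transpose_mat E * (C * (Gm * transpose_mat C)) =
      (transpose_mat E * C) * (Gm * transpose_mat C)"
    by (rule assoc_mult_mat[OF Et C_carrier correction_carrier(1), symmetric])
  also have "transpose_mat E * C = principal_submatrix N js"
    by (rule principal_submatrix_eq_congruence[OF N_carrier js_less, symmetric])
  also have "principal_submatrix N js * (Gm * transpose_mat C) = 
      (principal_submatrix N js * Gm) * transpose_mat C"
    using Gm(1) by (intro assoc_mult_mat[symmetric, of _ p p _ p _ n]) simp_all
  also have "\<dots> = transpose_mat C"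
    unfolding Gm(2) by (rule left_mult_one_mat[of _ p n]) (simp only: transpose_carrier_mat C_carrier)
  finally have "transpose_mat E * (C * (Gm * transpose_mat C)) = transpose_mat E * N"
    by (simp only: C_transpose)
  then have "(C * (Gm * transpose_mat C)) $$ (s, j) = N $$ (s, j)"
    using selection_mult[OF correction_carrier(2) js_less a(1) j]
      selection_mult[OF N_carrier js_less a(1) j] a(2) by metis
  moreover have "H $$ (s, j) = N $$ (s, j) - (C * (Gm * transpose_mat C)) $$ (s, j)"
    unfolding H_def using js_nth(1)[OF a(1)] a(2) j correction_carrier(2)
    by (intro index_minus_mat(1)) auto
  ultimately show ?thesis by simp
qed

text \<open>
  The correction in \<open>H\<close> injects currents at leaders only, so at a follower \<open>H\<close> still responds like
  \<open>N\<close>.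
\<close>
lemma L_H_follower_row:
  assumes i: "i < n" "i \<notin> set (l # js)" and j: "j < n"
  shows "(L * H) $$ (i, j) = (if i = j then 1 else 0)"
proof -
  have LC: "(L * C) $$ (i, a) = 0" if "a < p" for a
  proof -
    have "L * C = (L * N) * E"
      by (rule assoc_mult_mat[OF L_carrier N_carrier selection_carrier, symmetric])
    then have "(L * C) $$ (i, a) = (L * N) $$ (i, js ! a)"
      using mult_selection[OF square_carrier(1)[OF L_carrier N_carrier] js_less i(1) that]
      by simp
    then show ?thesis
      using L_N[OF i(1) js_nth(1)[OF that]] i(2) that by auto
  qed
  have "L * H = L * N - L * (C * (Gm * transpose_mat C))"
    unfolding H_def by (rule mult_minus_distrib_mat[OF L_carrier N_carrier correction_carrier(2)])
  also have "L * (C * (Gm * transpose_mat C)) = (L * C) * (Gm * transpose_mat C)"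
    by (rule assoc_mult_mat[OF L_carrier C_carrier correction_carrier(1), symmetric])
  finally have eq: "L * H = L * N - (L * C) * (Gm * transpose_mat C)" .
  have LCc: "L * C \<in> carrier_mat n p" by (rule mult_carrier_mat[OF L_carrier C_carrier])
  have "((L * C) * (Gm * transpose_mat C)) $$ (i, j) = 0"
    by (rule mult_mat_row_zero[OF LCc correction_carrier(1) i(1) j LC])
  moreover have "(L * H) $$ (i, j) = (L * N) $$ (i, j) - ((L * C) * (Gm * transpose_mat C)) $$ (i, j)"
    unfolding eq using i(1) j mult_carrier_mat[OF LCc correction_carrier(1)]
    by (intro index_minus_mat(1)) auto
  ultimately show ?thesis using L_N[OF i(1) j] i(2) by simp
qed

lemma trace_N: "mat_trace N = mat_trace P + real n * P $$ (l, l)"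
proof -
  have "mat_trace N = (\<Sum>i<n. P $$ (i, i)) - 2 * (\<Sum>i<n. P $$ (i, l)) + real n * P $$ (l, l)"
    by (simp add: mat_trace_def grounded_inverse_def sum.distrib sum_subtractf sum_distrib_left)
  then show ?thesis using l_less by (simp add: P_column_sum mat_trace_def)
qed

lemma trace_H:
  "mat_trace H = mat_trace P + real n * P $$ (l, l)
     - (\<Sum>a<p. \<Sum>b<p. Gm $$ (a, b) * (N * N) $$ (js ! b, js ! a))"
proof -
  have NN: "(transpose_mat C * C) $$ (b, a) = (N * N) $$ (js ! b, js ! a)" if "a < p" "b < p" for a b
  proof -
    have "(transpose_mat C * C) $$ (b, a) = (\<Sum>q<n. N $$ (q, js ! b) * N $$ (q, js ! a))"
      using that by (subst index_mult_mat_sum[of _ p n _ p])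
        (simp_all add: C_nth[symmetric] del: index_mult_mat(1))
    also have "\<dots> = (\<Sum>q<n. N $$ (js ! b, q) * N $$ (q, js ! a))"
      using that by (intro sum.cong) (auto simp: N_commute js_nth)
    also have "\<dots> = (N * N) $$ (js ! b, js ! a)"
      using that by (subst index_mult_mat_sum[of _ n n _ n]) (simp_all add: js_nth)
    finally show ?thesis .
  qed
  have "mat_trace (C * (Gm * transpose_mat C)) = mat_trace (Gm * transpose_mat C * C)"
    by (rule mat_trace_comm[OF C_carrier correction_carrier(1)])
  also have "Gm * transpose_mat C * C = Gm * (transpose_mat C * C)"
    using Gm(1) by (intro assoc_mult_mat[of _ p p _ n _ p]) (simp_all only: transpose_carrier_mat C_carrier)
  also have "mat_trace \<dots> = (\<Sum>a<p. (Gm * (transpose_mat C * C)) $$ (a, a))"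
    using Gm(1) by (simp add: mat_trace_def)
  also have "\<dots> = (\<Sum>a<p. \<Sum>b<p. Gm $$ (a, b) * (N * N) $$ (js ! b, js ! a))"
  proof (rule sum.cong[OF refl])
    fix a assume "a \<in> {..<p}"
    then have a: "a < p" by simp
    have CtC: "transpose_mat C * C \<in> carrier_mat p p"
      by (rule mult_carrier_mat[of _ p n]) (simp_all only: transpose_carrier_mat C_carrier)
    show "(Gm * (transpose_mat C * C)) $$ (a, a) =
        (\<Sum>b<p. Gm $$ (a, b) * (N * N) $$ (js ! b, js ! a))"
      unfolding index_mult_mat_sum[OF Gm(1) CtC a a]
      using a by (intro sum.cong) (simp_all add: NN del: index_mult_mat(1))
  qed
  finally show ?thesis
    unfolding H_def mat_trace_minus[OF N_carrier correction_carrier(2)] trace_N by simp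
qed

end

section \<open>Trace and determinant in terms of the pseudoinverse\<close>

text \<open>
  Block elimination: the bordered matrix is the product of the unitriangular matrix with blocks
  \<open>1, R G, 0, 1\<close> and the block-triangular one with blocks \<open>s - R G C, 0, C, D\<close>.
\<close>
lemma det_schur_complement:
  fixes s R C D G :: "'a :: idom mat"
  assumes s: "s \<in> carrier_mat 1 1" and R: "R \<in> carrier_mat 1 p" and C: "C \<in> carrier_mat p 1"
    and D: "D \<in> carrier_mat p p" and G: "G \<in> carrier_mat p p" and inv: "G * D = 1\<^sub>m p"
  shows "det (four_block_mat s R C D) = (s - R * G * C) $$ (0, 0) * det D"
proof -
  let ?V = "four_block_mat (1\<^sub>m 1) (R * G) (0\<^sub>m p 1) (1\<^sub>m p)"
  let ?W = "four_block_mat (s - R * G * C) (0\<^sub>m 1 p) C D"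
  have RG: "R * G \<in> carrier_mat 1 p" by (rule mult_carrier_mat[OF R G])
  have RGC: "R * G * C \<in> carrier_mat 1 1" by (rule mult_carrier_mat[OF RG C])
  have RGD: "R * G * D = R"
    using assoc_mult_mat[OF R G D] R by (simp add: inv right_mult_one_mat[of _ 1 p])
  have blocks: "1\<^sub>m 1 * (s - R * G * C) + R * G * C = s" "1\<^sub>m 1 * 0\<^sub>m 1 p + R * G * D = R"
    "0\<^sub>m p 1 * (s - R * G * C) + 1\<^sub>m p * C = C" "0\<^sub>m p 1 * 0\<^sub>m 1 p + 1\<^sub>m p * D = D"
    unfolding RGD using s R C D RG RGC by (auto simp del: index_mult_mat(1) intro!: eq_matI)
  have "four_block_mat s R C D = ?V * ?W"
    by (subst mult_four_block_mat[of _ 1 1 _ p _ p _ _ 1 _ p])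
      (use s R C D RG RGC minus_carrier_mat[OF RGC] in \<open>simp_all only: blocks one_carrier_mat zero_carrier_mat\<close>)
  moreover have "det ?V = 1"
    by (subst det_four_block_mat_lower_left_zero[of _ 1 _ p]) (use RG in simp_all)
  moreover have "det ?W = (s - R * G * C) $$ (0, 0) * det D"
    by (subst det_four_block_mat_upper_right_zero[of _ 1 _ p])
      (use C D RGC minus_carrier_mat[OF RGC] in \<open>simp_all add: det_single del: index_minus_mat index_mult_mat(1)\<close>)
  moreover have "?V \<in> carrier_mat (1 + p) (1 + p)" "?W \<in> carrier_mat (1 + p) (1 + p)"
    by (rule four_block_carrier_mat; use D minus_carrier_mat[OF RGC] in simp)+
  ultimately show ?thesis by (simp only: det_mult[of _ "1 + p"] mult_1_left)
qed

text \<open>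
  Adding the first row to all other rows and then the first column to all other columns, expressed as
  the congruence with a unitriangular matrix \<open>U\<close>.
\<close>
lemma det_add_first_row_col:
  fixes X :: "'a :: comm_ring_1 mat"
  assumes X: "X \<in> carrier_mat m m" and m: "0 < m"
  shows "det (mat m m (\<lambda>(i, j). X $$ (i, j) + (if i = 0 then 0 else X $$ (0, j))
       + (if j = 0 then 0 else X $$ (i, 0)) + (if i = 0 \<or> j = 0 then 0 else X $$ (0, 0)))) = det X"
proof -
  define U :: "'a mat" where
    "U = mat m m (\<lambda>(i, k). (if k = i then 1 else 0) + (if k = 0 then (if i = 0 then 0 else 1) else 0))"
  have U: "U \<in> carrier_mat m m" by (simp add: U_def)
  have UX: "(U * X) $$ (i, j) = X $$ (i, j) + (if i = 0 then 0 else X $$ (0, j))"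
    if "i < m" "j < m" for i j
  proof -
    have "(U * X) $$ (i, j) = (\<Sum>k<m. (if k = i then X $$ (k, j) else 0)
        + (if k = 0 then (if i = 0 then 0 else X $$ (k, j)) else 0))"
      using U X that
      by (auto simp: scalar_prod_def atLeast0LessThan U_def algebra_simps intro!: sum.cong)
    then show ?thesis using that m by (simp add: sum.distrib)
  qed
  have UXc: "U * X \<in> carrier_mat m m" by (rule mult_carrier_mat[OF U X])
  have UXU: "(U * X * transpose_mat U) $$ (i, j) =
      (U * X) $$ (i, j) + (if j = 0 then 0 else (U * X) $$ (i, 0))" if "i < m" "j < m" for i j
  proof -
    have "(U * X * transpose_mat U) $$ (i, j) = (\<Sum>k<m. (U * X) $$ (i, k) * transpose_mat U $$ (k, j))"
      by (rule index_mult_mat_sum[OF UXc _ that]) (use U in simp)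
    also have "\<dots> = (\<Sum>k<m. (if k = j then (U * X) $$ (i, k) else 0)
        + (if k = 0 then (if j = 0 then 0 else (U * X) $$ (i, k)) else 0))"
    proof (rule sum.cong[OF refl])
      fix k assume "k \<in> {..<m}"
      then have Ut: "transpose_mat U $$ (k, j) =
          (if k = j then 1 else 0) + (if k = 0 then (if j = 0 then 0 else 1) else 0)"
        using that by (simp add: U_def)
      show "(U * X) $$ (i, k) * transpose_mat U $$ (k, j) = (if k = j then (U * X) $$ (i, k) else 0)
        + (if k = 0 then (if j = 0 then 0 else (U * X) $$ (i, k)) else 0)"
        unfolding Ut by (simp add: distrib_left)
    qed
    finally show ?thesis using that m by (simp add: sum.distrib del: index_mult_mat(1))
  qed
  have "mat m m (\<lambda>(i, j). X $$ (i, j) + (if i = 0 then 0 else X $$ (0, j))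
       + (if j = 0 then 0 else X $$ (i, 0)) + (if i = 0 \<or> j = 0 then 0 else X $$ (0, 0))) =
      U * X * transpose_mat U"
    using U X m by (intro eq_matI) (auto simp: UX UXU simp del: index_mult_mat(1) assoc_mult_mat)
  moreover have "det U = 1"
    by (subst det_lower_triangular[OF _ U]) (auto simp: U_def prod_list_diag_prod intro!: prod.neutral)
  ultimately show ?thesis
    using U X UXc by (simp add: det_mult[of _ m] det_transpose del: assoc_mult_mat)
qed

context connected_laplacian
begin

definition biharmonic :: "nat \<Rightarrow> nat \<Rightarrow> real" where
  "biharmonic i j = (P * P) $$ (i, i) + (P * P) $$ (j, j) - 2 * (P * P) $$ (i, j)"

end

context leader_grounding
begin

text \<open>
  With \<open>p\<^sub>i\<close> the \<open>i\<close>-th row of \<open>L\<^sup>+\<close>, row \<open>i\<close> of \<open>N\<close> is \<open>p\<^sub>i - p\<^sub>l\<close> plus a constant vector.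
  Rows of \<open>L\<^sup>+\<close> sum to zero, so the mixed terms of the inner product drop out. The inner product of
  \<open>p\<^sub>i - p\<^sub>l\<close> and \<open>p\<^sub>j - p\<^sub>l\<close> is then given by the law of cosines, because the biharmonic distance of \<open>i\<close>
  and \<open>j\<close> is the squared length of \<open>p\<^sub>i - p\<^sub>j\<close>.
\<close>
lemma N_squared:
  assumes i: "i < n" and j: "j < n"
  shows "(N * N) $$ (i, j) = (biharmonic i l + biharmonic j l - biharmonic i j) / 2
      + real n * (P $$ (l, l) - P $$ (i, l)) * (P $$ (l, l) - P $$ (j, l))"
proof -
  (* the constants by which the rows of N differ from differences of rows of the pseudoinverse *)
  let ?a = "P $$ (l, l) - P $$ (i, l)" and ?b = "P $$ (l, l) - P $$ (j, l)"
  have PP: "(P * P) $$ (u, v) = (\<Sum>q<n. P $$ (u, q) * P $$ (v, q))" if "u < n" "v < n" for u v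
    unfolding index_mult_mat_sum[OF P_carrier P_carrier that]
    using that by (intro sum.cong) (auto simp: P_commute[of v])
  have "(N * N) $$ (i, j) =
      (\<Sum>q<n. (P $$ (i, q) - P $$ (l, q) + ?a) * (P $$ (j, q) - P $$ (l, q) + ?b))"
    unfolding index_mult_mat_sum[OF N_carrier N_carrier i j]
  proof (rule sum.cong[OF refl])
    fix q assume "q \<in> {..<n}"
    then have q: "q < n" by simp
    show "N $$ (i, q) * N $$ (q, j) =
        (P $$ (i, q) - P $$ (l, q) + ?a) * (P $$ (j, q) - P $$ (l, q) + ?b)"
      using i j q l_less P_commute[OF q l_less] P_commute[OF q j]
      by (simp add: grounded_inverse_def algebra_simps)
  qed
  also have "\<dots> = (\<Sum>q<n. P $$ (i, q) * P $$ (j, q)) - (\<Sum>q<n. P $$ (i, q) * P $$ (l, q))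
      - (\<Sum>q<n. P $$ (j, q) * P $$ (l, q)) + (\<Sum>q<n. P $$ (l, q) * P $$ (l, q))
      + ?b * ((\<Sum>q<n. P $$ (i, q)) - (\<Sum>q<n. P $$ (l, q)))
      + ?a * ((\<Sum>q<n. P $$ (j, q)) - (\<Sum>q<n. P $$ (l, q))) + real n * ?a * ?b"
  proof -
    have expand: "(x - y + a) * (z - y + b) =
        x * z - x * y - z * y + y * y + b * (x - y) + a * (z - y) + a * b" for x y z a b :: real
      by (simp add: algebra_simps)
    show ?thesis
      unfolding expand by (simp add: sum.distrib sum_subtractf flip: sum_distrib_left)
  qed
  also have "\<dots> = (P * P) $$ (i, j) - (P * P) $$ (i, l) - (P * P) $$ (j, l) + (P * P) $$ (l, l)
      + real n * ?a * ?b"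
    using i j l_less by (simp add: PP P_row_sum del: index_mult_mat(1))
  finally show ?thesis by (simp add: biharmonic_def field_simps del: index_mult_mat(1))
qed

text \<open>
  The first two biharmonic terms of the law of cosines contribute equally, since \<open>G\<close> is symmetric;
  together they cancel the factor one half.
\<close>
lemma trace_H_biharmonic:
  "mat_trace H = mat_trace P
     + real n * (P $$ (l, l) - (\<Sum>a<p. \<Sum>b<p. Gm $$ (a, b)
         * (P $$ (l, l) - P $$ (js ! a, l)) * (P $$ (l, l) - P $$ (js ! b, l))))
     + 1 / 2 * (\<Sum>a<p. \<Sum>b<p. Gm $$ (a, b) * biharmonic (js ! b) (js ! a))
     - (\<Sum>a<p. \<Sum>b<p. Gm $$ (a, b) * biharmonic (js ! b) l)"
proof -
  have G_commute: "Gm $$ (a, b) = Gm $$ (b, a)" if "a < p" "b < p" for a b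
    using Gm_sym Gm(1) that by (metis carrier_matD index_transpose_mat(1))
  have "(\<Sum>a<p. \<Sum>b<p. Gm $$ (a, b) * biharmonic (js ! a) l) =
      (\<Sum>b<p. \<Sum>a<p. Gm $$ (a, b) * biharmonic (js ! a) l)" by (rule sum.swap)
  also have "\<dots> = (\<Sum>a<p. \<Sum>b<p. Gm $$ (a, b) * biharmonic (js ! b) l)"
    by (intro sum.cong) (auto simp: G_commute)
  finally have swap: "(\<Sum>a<p. \<Sum>b<p. Gm $$ (a, b) * biharmonic (js ! a) l) =
      (\<Sum>a<p. \<Sum>b<p. Gm $$ (a, b) * biharmonic (js ! b) l)" .
  have "(\<Sum>a<p. \<Sum>b<p. Gm $$ (a, b) * (N * N) $$ (js ! b, js ! a)) =
      (\<Sum>a<p. \<Sum>b<p. 1 / 2 * (Gm $$ (a, b) * biharmonic (js ! b) l)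
        + 1 / 2 * (Gm $$ (a, b) * biharmonic (js ! a) l)
        - 1 / 2 * (Gm $$ (a, b) * biharmonic (js ! b) (js ! a))
        + real n * (Gm $$ (a, b)
         * (P $$ (l, l) - P $$ (js ! a, l)) * (P $$ (l, l) - P $$ (js ! b, l))))"
    by (intro sum.cong refl)
      (simp add: N_squared js_nth field_simps del: index_mult_mat(1))
  also have "\<dots> = 1 / 2 * (\<Sum>a<p. \<Sum>b<p. Gm $$ (a, b) * biharmonic (js ! b) l)
        + 1 / 2 * (\<Sum>a<p. \<Sum>b<p. Gm $$ (a, b) * biharmonic (js ! a) l)
        - 1 / 2 * (\<Sum>a<p. \<Sum>b<p. Gm $$ (a, b) * biharmonic (js ! b) (js ! a))
        + real n * (\<Sum>a<p. \<Sum>b<p. Gm $$ (a, b)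
         * (P $$ (l, l) - P $$ (js ! a, l)) * (P $$ (l, l) - P $$ (js ! b, l)))"
    unfolding sum.distrib sum_subtractf sum_distrib_left ..
  finally show ?thesis
    unfolding trace_H by (simp only: swap right_diff_distrib)
qed

text \<open>
  Undoing the shift by node \<open>l\<close> turns the leader block of \<open>L\<^sup>+\<close> into the leader block of \<open>N\<close> with a
  border, and the Schur complement of that border is the quadratic expression that occurs in the trace
  of \<open>H\<close>.
\<close>
lemma det_leader_block:
  "det Gm * det (principal_submatrix P (l # js)) =
     P $$ (l, l) - (\<Sum>a<p. \<Sum>b<p. Gm $$ (a, b)
         * (P $$ (l, l) - P $$ (js ! a, l)) * (P $$ (l, l) - P $$ (js ! b, l)))"
proof -
  define c where "c a = P $$ (l, l) - P $$ (js ! a, l)" for a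
  define s where "s = mat 1 1 (\<lambda>_. P $$ (l, l))"
  define R where "R = mat 1 p (\<lambda>(_, b). - c b)"
  define K where "K = mat p 1 (\<lambda>(a, _). - c a)"
  let ?D = "principal_submatrix N js"
  let ?X = "four_block_mat s R K ?D"
  have carriers: "s \<in> carrier_mat 1 1" "R \<in> carrier_mat 1 p" "K \<in> carrier_mat p 1"
    by (simp_all add: s_def R_def K_def)
  have X: "?X \<in> carrier_mat (Suc p) (Suc p)"
    using four_block_carrier_mat[OF carriers(1) Nsub_carrier] by simp
  have P_l: "P $$ (l, js ! a) = P $$ (js ! a, l)" if "a < p" for a
    using P_commute[OF l_less js_nth(1)[OF that]] .
  have "principal_submatrix P (l # js) = mat (Suc p) (Suc p) (\<lambda>(i, j). ?X $$ (i, j)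
       + (if i = 0 then 0 else ?X $$ (0, j)) + (if j = 0 then 0 else ?X $$ (i, 0))
       + (if i = 0 \<or> j = 0 then 0 else ?X $$ (0, 0)))"
  proof (rule eq_matI)
    fix i j
    assume "i < dim_row (mat (Suc p) (Suc p) (\<lambda>(i, j). ?X $$ (i, j)
       + (if i = 0 then 0 else ?X $$ (0, j)) + (if j = 0 then 0 else ?X $$ (i, 0))
       + (if i = 0 \<or> j = 0 then 0 else ?X $$ (0, 0))))"
     and "j < dim_col (mat (Suc p) (Suc p) (\<lambda>(i, j). ?X $$ (i, j)
       + (if i = 0 then 0 else ?X $$ (0, j)) + (if j = 0 then 0 else ?X $$ (i, 0))
       + (if i = 0 \<or> j = 0 then 0 else ?X $$ (0, 0))))"
    then have "i < Suc p" "j < Suc p" by auto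
    then show "principal_submatrix P (l # js) $$ (i, j) =
        mat (Suc p) (Suc p) (\<lambda>(i, j). ?X $$ (i, j)
       + (if i = 0 then 0 else ?X $$ (0, j)) + (if j = 0 then 0 else ?X $$ (i, 0))
       + (if i = 0 \<or> j = 0 then 0 else ?X $$ (0, 0))) $$ (i, j)"
      using l_less
      by (cases i; cases j)
        (auto simp: principal_submatrix_def s_def R_def K_def c_def grounded_inverse_def js_nth
          P_l)
  qed (auto simp: principal_submatrix_def)
  then have "det (principal_submatrix P (l # js)) = det ?X"
    by (simp only: det_add_first_row_col[OF X zero_less_Suc])
  also have "\<dots> = (s - R * Gm * K) $$ (0, 0) * det ?D"
    by (rule det_schur_complement[OF carriers Nsub_carrier Gm(1) Gm(3)])
  also have "(s - R * Gm * K) $$ (0, 0) = P $$ (l, l) - (R * Gm * K) $$ (0, 0)"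
    using mult_carrier_mat[OF mult_carrier_mat[OF carriers(2) Gm(1)] carriers(3)]
    by (subst index_minus_mat(1)) (auto simp: s_def simp del: index_mult_mat(1))
  also have "(R * Gm * K) $$ (0, 0) = (\<Sum>b<p. (\<Sum>a<p. - c a * Gm $$ (a, b)) * - c b)"
  proof -
    have "(R * Gm) $$ (0, b) = (\<Sum>a<p. - c a * Gm $$ (a, b))" if "b < p" for b
      using that by (subst index_mult_mat_sum[OF carriers(2) Gm(1)]) (simp_all add: R_def)
    then show ?thesis
      by (subst index_mult_mat_sum[OF mult_carrier_mat[OF carriers(2) Gm(1)] carriers(3)])
        (simp_all add: K_def del: index_mult_mat(1))
  qed
  also have "\<dots> = (\<Sum>b<p. \<Sum>a<p. Gm $$ (a, b) * c a * c b)"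
    unfolding sum_distrib_right by (intro sum.cong) auto
  also have "\<dots> = (\<Sum>a<p. \<Sum>b<p. Gm $$ (a, b) * c a * c b)" by (rule sum.swap)
  finally have "det Gm * det (principal_submatrix P (l # js)) =
      det (Gm * ?D) * (P $$ (l, l) - (\<Sum>a<p. \<Sum>b<p. Gm $$ (a, b) * c a * c b))"
    using det_mult[OF Gm(1) Nsub_carrier] by simp
  then show ?thesis by (simp add: Gm(3) c_def)
qed

end

section \<open>The limit of infinite gain\<close>

lemma leader_gain_carrier [simp]: "leader_gain n S k \<in> carrier_mat n n"
  by (simp add: leader_gain_def)

lemma leader_gain_quadratic_form:
  assumes x: "x \<in> carrier_vec n" and S: "S \<subseteq> {..<n}"
  shows "x \<bullet> (leader_gain n S k *\<^sub>v x) = k * (\<Sum>s\<in>S. (x $ s)\<^sup>2)"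
proof -
  have gain: "(leader_gain n S k *\<^sub>v x) $ i = (if i \<in> S then k * x $ i else 0)" if i: "i < n" for i
  proof -
    have "(leader_gain n S k *\<^sub>v x) $ i =
        (\<Sum>q<n. (if i = q then if q \<in> S then k else 0 else 0) * x $ q)"
      using i x by (simp add: leader_gain_def mat_diag_def scalar_prod_def atLeast0LessThan)
    also have "\<dots> = (\<Sum>q<n. if q = i then (if q \<in> S then k else 0) * x $ q else 0)"
      by (intro sum.cong) auto
    finally show ?thesis using i by simp
  qed
  have "x \<bullet> (leader_gain n S k *\<^sub>v x) = (\<Sum>i<n. x $ i * (leader_gain n S k *\<^sub>v x) $ i)"
    by (auto simp: scalar_prod_def atLeast0LessThan leader_gain_def mat_diag_def)
  also have "\<dots> = (\<Sum>i<n. if i \<in> S then k * (x $ i)\<^sup>2 else 0)"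
    by (intro sum.cong) (auto simp: gain power2_eq_square simp del: index_mult_mat_vec)
  also have "\<dots> = (\<Sum>i\<in>{..<n} \<inter> S. k * (x $ i)\<^sup>2)"
    by (rule sum.inter_restrict[symmetric]) simp
  also have "{..<n} \<inter> S = S" using S by blast
  finally show ?thesis by (simp add: sum_distrib_left)
qed

context connected_laplacian
begin

lemma controlled_quadratic_form:
  assumes x: "x \<in> carrier_vec n" and S: "S \<subseteq> {..<n}"
  shows "x \<bullet> ((L + leader_gain n S k) *\<^sub>v x) = x \<bullet> (L *\<^sub>v x) + k * (\<Sum>s\<in>S. (x $ s)\<^sup>2)"
proof -
  have "(L + leader_gain n S k) *\<^sub>v x = L *\<^sub>v x + leader_gain n S k *\<^sub>v x"
    by (rule add_mult_distrib_mat_vec[OF L_carrier leader_gain_carrier x])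
  then show ?thesis
    using x by (simp add: scalar_prod_add_distrib[of _ n] leader_gain_quadratic_form[OF x S])
qed

lemma positive_definite_controlled:
  assumes S: "S \<subseteq> {..<n}" "S \<noteq> {}" and k: "0 < k"
  shows "positive_definite n (L + leader_gain n S k)"
  unfolding positive_definite_def
proof (intro ballI impI)
  fix x :: "real vec" assume x: "x \<in> carrier_vec n" and "x \<noteq> 0\<^sub>v n"
  have fin: "finite S" using S(1) finite_subset by blast
  have gain_nonneg: "0 \<le> k * (\<Sum>s\<in>S. (x $ s)\<^sup>2)"
    using k by (intro mult_nonneg_nonneg sum_nonneg) auto
  have "x \<bullet> ((L + leader_gain n S k) *\<^sub>v x) \<noteq> 0"
  proof
    assume "x \<bullet> ((L + leader_gain n S k) *\<^sub>v x) = 0"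
    then have "x \<bullet> (L *\<^sub>v x) = 0" "k * (\<Sum>s\<in>S. (x $ s)\<^sup>2) = 0"
      using controlled_quadratic_form[OF x S(1), of k] gain_nonneg L_nonneg[OF x] by linarith+
    moreover obtain s where "s \<in> S" using S(2) by blast
    ultimately have "x $ s = 0" "s < n" "x \<bullet> (L *\<^sub>v x) = 0"
      using k fin S(1) by (auto simp: sum_nonneg_eq_0_iff)
    then have "x $ i = 0" if "i < n" for i
      using L_kernel[OF x _ that \<open>s < n\<close>] by simp
    then have "x = 0\<^sub>v n" using x by (intro eq_vecI) auto
    with \<open>x \<noteq> 0\<^sub>v n\<close> show False ..
  qed
  then show "0 < x \<bullet> ((L + leader_gain n S k) *\<^sub>v x)"
    using controlled_quadratic_form[OF x S(1), of k] gain_nonneg L_nonneg[OF x] by linarith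
qed

text \<open>
  Column \<open>s\<close> of the inverse, \<open>x\<close>, satisfies \<open>x \<bullet> M x = x\<^sub>s\<close>. As the left side is at least
  \<open>k x\<^sub>q\<^sup>2\<close> for every leader \<open>q\<close>, first \<open>x\<^sub>s \<le> 1 / k\<close> and then every \<open>\<bar>x\<^sub>t\<bar> \<le> 1 / k\<close>.
\<close>
lemma leader_entry_bound:
  assumes S: "S \<subseteq> {..<n}" and k: "0 < k"
    and E: "E \<in> carrier_mat n n" "(L + leader_gain n S k) * E = 1\<^sub>m n"
    and st: "s \<in> S" "t \<in> S"
  shows "\<bar>E $$ (t, s)\<bar> \<le> 1 / k"
proof -
  have fin: "finite S" using S finite_subset by blast
  have less: "s < n" "t < n" using S st by auto
  define x where "x = col E s"
  have x: "x \<in> carrier_vec n" using E less by (simp add: x_def)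
  have x_nth: "x $ i = E $$ (i, s)" if "i < n" for i using that E less by (simp add: x_def)
  have M: "L + leader_gain n S k \<in> carrier_mat n n" by (rule add_carrier_mat) simp
  have "(L + leader_gain n S k) *\<^sub>v x = col ((L + leader_gain n S k) * E) s"
    unfolding x_def by (rule col_mult2[OF M E(1) less(1), symmetric])
  also have "\<dots> = unit_vec n s" using E(2) less by simp
  finally have "x \<bullet> ((L + leader_gain n S k) *\<^sub>v x) = x $ s" using less by simp
  then have energy: "k * (\<Sum>q\<in>S. (x $ q)\<^sup>2) \<le> x $ s"
    using controlled_quadratic_form[OF x S, of k] L_nonneg[OF x] by linarith
  have bound: "k * (x $ q)\<^sup>2 \<le> x $ s" if "q \<in> S" for q
  proof -
    have "(x $ q)\<^sup>2 \<le> (\<Sum>q\<in>S. (x $ q)\<^sup>2)" using that fin by (intro member_le_sum) auto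
    then have "k * (x $ q)\<^sup>2 \<le> k * (\<Sum>q\<in>S. (x $ q)\<^sup>2)" using k by simp
    then show ?thesis using energy by linarith
  qed
  have "k * x $ s \<le> 1"
  proof (rule ccontr)
    assume "\<not> k * x $ s \<le> 1"
    then have large: "1 < k * x $ s" by simp
    then have "0 < k * x $ s" by linarith
    then have "0 < x $ s" by (rule zero_less_mult_pos[OF _ k])
    with large have "x $ s < (k * x $ s) * x $ s" by simp
    then show False using bound[OF st(1)] by (simp add: power2_eq_square mult.assoc)
  qed
  have "(k * x $ t)\<^sup>2 = k * (k * (x $ t)\<^sup>2)" by (simp add: power2_eq_square)
  also have "\<dots> \<le> k * x $ s" using bound[OF st(2)] k by simp
  also have "\<dots> \<le> 1" by fact
  finally have "\<bar>k * x $ t\<bar> \<le> 1" by (simp add: abs_square_le_1)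
  then show ?thesis using k less by (simp add: abs_mult x_nth field_simps)
qed

text \<open>
  Let \<open>E\<close> be the inverse of \<open>L + K\<close>, and let \<open>F = 1 - L H\<close>, which is supported on the leader rows.
  The gain does not see \<open>H\<close>, so \<open>(L + K) H = 1 - F\<close> and \<open>E = H + E F\<close>. Combining this with its
  transpose and \<open>H F = 0\<close> gives \<open>E = H + F\<^sup>T E F\<close>, where only the entries of \<open>E\<close> between leaders
  matter. Those tend to zero as the gain grows.
\<close>
lemma noise_free_limit:
  assumes S: "S \<subseteq> {..<n}" "S \<noteq> {}"
    and H: "H \<in> carrier_mat n n" "transpose_mat H = H"
    and H_leader: "\<And>s j. s \<in> S \<Longrightarrow> j < n \<Longrightarrow> H $$ (s, j) = 0"
    and LH: "\<And>i j. i < n \<Longrightarrow> i \<notin> S \<Longrightarrow> j < n \<Longrightarrow> (L * H) $$ (i, j) = (if i = j then 1 else 0)"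
  shows "((\<lambda>k. mat_trace (steady_state_covariance (L + leader_gain n S k) \<sigma>))
      \<longlongrightarrow> \<sigma>\<^sup>2 / 2 * mat_trace H) at_top"
proof -
  define M where "M k = L + leader_gain n S k" for k
  define F where "F = 1\<^sub>m n - L * H"
  have M: "M k \<in> carrier_mat n n" for k unfolding M_def by (rule add_carrier_mat) simp
  have M_sym: "transpose_mat (M k) = M k" for k
    unfolding M_def by (subst transpose_add[OF L_carrier leader_gain_carrier])
      (auto simp: L_sym leader_gain_def mat_diag_def intro!: arg_cong2[of _ _ _ _ "(+)"] eq_matI)
  have pd: "positive_definite n (M k)" if "0 < k" for k
    unfolding M_def by (rule positive_definite_controlled[OF S that])
  have LHc: "L * H \<in> carrier_mat n n" by (rule mult_carrier_mat[OF L_carrier H(1)])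
  have F: "F \<in> carrier_mat n n" unfolding F_def by (rule minus_carrier_mat[OF LHc])
  have F_follower: "F $$ (i, j) = 0" if "i < n" "i \<notin> S" "j < n" for i j
    unfolding F_def using LH[OF that] that LHc by (subst index_minus_mat(1)) auto
  have gain_H: "leader_gain n S k * H = 0\<^sub>m n n" for k
    unfolding leader_gain_def mat_diag_mult_left[OF H(1)]
    by (rule eq_matI) (auto simp: H_leader)
  have MH: "M k * H = 1\<^sub>m n - F" for k
  proof -
    have "M k * H = L * H + leader_gain n S k * H"
      unfolding M_def by (rule add_mult_distrib_mat[OF L_carrier leader_gain_carrier H(1)])
    then show ?thesis unfolding gain_H F_def using LHc
      by (intro eq_matI) (auto simp del: index_mult_mat(1))
  qed
  have HF: "H * F = 0\<^sub>m n n"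
  proof (rule eq_matI)
    fix i j assume "i < dim_row (0\<^sub>m n n :: real mat)" "j < dim_col (0\<^sub>m n n :: real mat)"
    then have ij: "i < n" "j < n" by auto
    have "(H * F) $$ (i, j) = (\<Sum>q<n. H $$ (i, q) * F $$ (q, j))"
      by (rule index_mult_mat_sum[OF H(1) F ij])
    also have "\<dots> = 0"
    proof (intro sum.neutral ballI)
      fix q assume "q \<in> {..<n}"
      then have q: "q < n" by simp
      have "H $$ (i, q) = H $$ (q, i)"
        using H ij(1) q by (metis carrier_matD index_transpose_mat(1))
      then show "H $$ (i, q) * F $$ (q, j) = 0"
        using H_leader[OF _ ij(1)] F_follower[OF q _ ij(2)] by (cases "q \<in> S") auto
    qed
    finally show "(H * F) $$ (i, j) = (0\<^sub>m n n :: real mat) $$ (i, j)" using ij by simp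
  qed (use H F in auto)
  have "\<exists>E. 0 < k \<longrightarrow> E \<in> carrier_mat n n \<and> M k * E = 1\<^sub>m n \<and> E * M k = 1\<^sub>m n" for k
    using positive_definite_inverse[OF M pd] by metis
  then obtain E where "\<forall>k. 0 < k \<longrightarrow> E k \<in> carrier_mat n n \<and> M k * E k = 1\<^sub>m n \<and> E k * M k = 1\<^sub>m n"
    by metis
  then have E: "E k \<in> carrier_mat n n" "M k * E k = 1\<^sub>m n" "E k * M k = 1\<^sub>m n" if "0 < k" for k
    using that by auto
  have E_split: "E k = H + transpose_mat F * (E k * F)" if k: "0 < k" for k
  proof -
    note Ek = E[OF k]
    have Ft: "transpose_mat F \<in> carrier_mat n n" using F by simp
    have EF: "E k * F \<in> carrier_mat n n" by (rule mult_carrier_mat[OF Ek(1) F])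
    have FtE: "transpose_mat F * E k \<in> carrier_mat n n" by (rule mult_carrier_mat[OF Ft Ek(1)])
    have "H = (E k * M k) * H" using H by (simp add: Ek(3))
    also have "\<dots> = E k * (1\<^sub>m n - F)"
      unfolding assoc_mult_mat[OF Ek(1) M H(1)] MH ..
    also have "\<dots> = E k - E k * F"
      using mult_minus_distrib_mat[OF Ek(1) one_carrier_mat F] Ek(1) by (simp add: right_mult_one_mat[of _ n n])
    finally have HE: "H = E k - E k * F" .
    have "H = transpose_mat (E k - E k * F)" using H(2) HE by simp
    also have "\<dots> = E k - transpose_mat F * E k"
      by (simp only: transpose_minus[OF Ek(1) EF] transpose_mult[OF Ek(1) F]
          inverse_symmetric[OF M M_sym Ek])
    finally have HE': "H = E k - transpose_mat F * E k" .
    have add_back: "X = Y + Z" if "Y = X - Z" "X \<in> carrier_mat n n" "Z \<in> carrier_mat n n" for X Y Z :: "real mat"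
      unfolding that(1) using that(2,3) by (intro eq_matI) auto
    have E1: "E k = H + E k * F" by (rule add_back[OF HE Ek(1) EF])
    have E2: "E k = H + transpose_mat F * E k" by (rule add_back[OF HE' Ek(1) FtE])
    have "E k * F = (H + transpose_mat F * E k) * F" using E2 by simp
    also have "\<dots> = H * F + transpose_mat F * E k * F"
      by (rule add_mult_distrib_mat[OF H(1) FtE F])
    also have "\<dots> = transpose_mat F * (E k * F)"
      unfolding HF assoc_mult_mat[OF Ft Ek(1) F]
      by (rule left_add_zero_mat[OF mult_carrier_mat[OF Ft EF]])
    finally show ?thesis using E1 by simp
  qed
  have E_leader: "((\<lambda>k. E k $$ (s, t)) \<longlongrightarrow> 0) at_top" if "s \<in> S" "t \<in> S" for s t
  proof (rule tendsto_rabs_zero_cancel, rule tendsto_sandwich)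
    show "eventually (\<lambda>k. 0 \<le> \<bar>E k $$ (s, t)\<bar>) at_top" by simp
    show "eventually (\<lambda>k. \<bar>E k $$ (s, t)\<bar> \<le> 1 / k) at_top"
      using eventually_gt_at_top[of 0]
    proof eventually_elim
      case (elim k)
      show ?case using leader_entry_bound[OF S(1) elim _ _ that(2,1)] E[OF elim] by (simp add: M_def)
    qed
    show "((\<lambda>k :: real. 1 / k) \<longlongrightarrow> 0) at_top"
      by (intro tendsto_divide_0[OF tendsto_const] filterlim_at_top_imp_at_infinity filterlim_ident)
  qed simp
  have trace_E: "mat_trace (E k) =
      mat_trace H + (\<Sum>i<n. \<Sum>s\<in>S. \<Sum>t\<in>S. F $$ (s, i) * E k $$ (s, t) * F $$ (t, i))"
    if k: "0 < k" for k
  proof -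
    note Ek = E[OF k]
    have Ft: "transpose_mat F \<in> carrier_mat n n" using F by simp
    have EF: "E k * F \<in> carrier_mat n n" by (rule mult_carrier_mat[OF Ek(1) F])
    have restrict: "(\<Sum>q<n. f q) = (\<Sum>q\<in>S. f q)" if "\<And>q. q < n \<Longrightarrow> q \<notin> S \<Longrightarrow> f q = 0"
      for f :: "nat \<Rightarrow> real"
      using S(1) that by (intro sum.mono_neutral_right) auto
    have entry: "(transpose_mat F * (E k * F)) $$ (i, i) =
        (\<Sum>s\<in>S. \<Sum>t\<in>S. F $$ (s, i) * E k $$ (s, t) * F $$ (t, i))" if i: "i < n" for i
    proof -
      have "(transpose_mat F * (E k * F)) $$ (i, i) = (\<Sum>q<n. F $$ (q, i) * (E k * F) $$ (q, i))"
        unfolding index_mult_mat_sum[OF Ft EF i i] using F i by (intro sum.cong) auto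
      also have "\<dots> = (\<Sum>q\<in>S. F $$ (q, i) * (E k * F) $$ (q, i))"
        by (rule restrict) (simp add: F_follower i)
      also have "\<dots> = (\<Sum>s\<in>S. \<Sum>t\<in>S. F $$ (s, i) * E k $$ (s, t) * F $$ (t, i))"
      proof (rule sum.cong[OF refl])
        fix s assume "s \<in> S"
        then have "s < n" using S(1) by auto
        then have "(E k * F) $$ (s, i) = (\<Sum>q<n. E k $$ (s, q) * F $$ (q, i))"
          by (intro index_mult_mat_sum[OF Ek(1) F] i)
        also have "\<dots> = (\<Sum>t\<in>S. E k $$ (s, t) * F $$ (t, i))"
          by (rule restrict) (simp add: F_follower i)
        finally show "F $$ (s, i) * (E k * F) $$ (s, i) =
            (\<Sum>t\<in>S. F $$ (s, i) * E k $$ (s, t) * F $$ (t, i))"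
          by (simp add: sum_distrib_left mult.assoc)
      qed
      finally show ?thesis .
    qed
    have "mat_trace (E k) = mat_trace H + mat_trace (transpose_mat F * (E k * F))"
      using mat_trace_add[OF H(1) mult_carrier_mat[OF Ft EF]] E_split[OF k] by simp
    also have "mat_trace (transpose_mat F * (E k * F)) =
        (\<Sum>i<n. \<Sum>s\<in>S. \<Sum>t\<in>S. F $$ (s, i) * E k $$ (s, t) * F $$ (t, i))"
      unfolding mat_trace_def using F by (intro sum.cong) (auto simp: entry simp del: index_mult_mat(1))
    finally show ?thesis .
  qed
  have "((\<lambda>k. \<sigma>\<^sup>2 / 2 * (mat_trace H +
      (\<Sum>i<n. \<Sum>s\<in>S. \<Sum>t\<in>S. F $$ (s, i) * E k $$ (s, t) * F $$ (t, i))))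
      \<longlongrightarrow> \<sigma>\<^sup>2 / 2 * (mat_trace H + (\<Sum>i<n. \<Sum>s\<in>S. \<Sum>t\<in>S. F $$ (s, i) * 0 * F $$ (t, i)))) at_top"
    by (intro tendsto_intros E_leader)
  then have lim: "((\<lambda>k. \<sigma>\<^sup>2 / 2 * (mat_trace H +
      (\<Sum>i<n. \<Sum>s\<in>S. \<Sum>t\<in>S. F $$ (s, i) * E k $$ (s, t) * F $$ (t, i))))
      \<longlongrightarrow> \<sigma>\<^sup>2 / 2 * mat_trace H) at_top" by simp
  show ?thesis
  proof (rule Lim_transform_eventually[OF lim])
    show "\<forall>\<^sub>F k in at_top. \<sigma>\<^sup>2 / 2 * (mat_trace H +
        (\<Sum>i<n. \<Sum>s\<in>S. \<Sum>t\<in>S. F $$ (s, i) * E k $$ (s, t) * F $$ (t, i))) =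
      mat_trace (steady_state_covariance (L + leader_gain n S k) \<sigma>)"
      using eventually_gt_at_top[of 0]
    proof eventually_elim
      case (elim k)
      have "steady_state_covariance (M k) \<sigma> = (\<sigma>\<^sup>2 / 2) \<cdot>\<^sub>m E k"
        by (rule steady_state_covariance_eq[OF M M_sym pd[OF elim] E[OF elim]])
      moreover have "mat_trace ((\<sigma>\<^sup>2 / 2) \<cdot>\<^sub>m E k) = \<sigma>\<^sup>2 / 2 * mat_trace (E k)"
        using E(1)[OF elim] by (auto simp: mat_trace_def sum_distrib_left)
      ultimately show ?case by (simp add: M_def trace_E[OF elim])
    qed
  qed
qed

text \<open>
  The \<open>i\<close>-th diagonal entry of \<open>H\<close> is the energy of its \<open>i\<close>-th column. For a follower \<open>i\<close> it cannot be
  zero: the column would be constant, hence zero as it vanishes at the leaders, although \<open>L H\<close> has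
  a one at position \<open>(i, i)\<close>.
\<close>
lemma grounded_trace_positive:
  assumes S: "S \<subset> {..<n}" "S \<noteq> {}"
    and H: "H \<in> carrier_mat n n"
    and H_leader: "\<And>s j. s \<in> S \<Longrightarrow> j < n \<Longrightarrow> H $$ (s, j) = 0"
    and LH: "\<And>i j. i < n \<Longrightarrow> i \<notin> S \<Longrightarrow> j < n \<Longrightarrow> (L * H) $$ (i, j) = (if i = j then 1 else 0)"
  shows "0 < mat_trace H"
proof -
  have diag: "col H i \<bullet> (L *\<^sub>v col H i) = H $$ (i, i)" if i: "i < n" for i
  proof -
    have "L *\<^sub>v col H i = col (L * H) i" by (rule col_mult2[OF L_carrier H i, symmetric])
    then have "col H i \<bullet> (L *\<^sub>v col H i) = (\<Sum>q<n. H $$ (q, i) * (L * H) $$ (q, i))"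
      using H i by (simp add: scalar_prod_def atLeast0LessThan del: index_mult_mat(1))
    also have "\<dots> = (\<Sum>q<n. if q = i then H $$ (q, i) else 0)"
    proof (rule sum.cong[OF refl])
      fix q assume "q \<in> {..<n}"
      then show "H $$ (q, i) * (L * H) $$ (q, i) = (if q = i then H $$ (q, i) else 0)"
        using H_leader[OF _ i] LH[OF _ _ i] by (cases "q \<in> S") auto
    qed
    finally show ?thesis using i by simp
  qed
  have nonneg: "0 \<le> H $$ (i, i)" if "i < n" for i
    using L_nonneg[of "col H i"] diag[OF that] that H by simp
  obtain i where i: "i < n" "i \<notin> S" using S(1) by blast
  obtain s where s: "s \<in> S" "s < n" using S by blast
  have "H $$ (i, i) \<noteq> 0"
  proof
    assume "H $$ (i, i) = 0"
    then have "col H i \<bullet> (L *\<^sub>v col H i) = 0" using diag[OF i(1)] by simp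
    then have "col H i $ q = col H i $ s" if "q < n" for q
      using L_kernel[OF _ _ that s(2), of "col H i"] H i(1) by simp
    then have "H $$ (q, i) = 0" if "q < n" for q
      using that H i(1) s H_leader[OF s(1) i(1)] by simp
    then have "(L * H) $$ (i, i) = 0"
      by (subst index_mult_mat_sum[OF L_carrier H i(1) i(1)]) simp
    then show False using LH[OF i i(1)] by simp
  qed
  then have "0 < H $$ (i, i)" using nonneg[OF i(1)] by simp
  also have "\<dots> \<le> (\<Sum>q<n. H $$ (q, q))"
    using i nonneg by (intro member_le_sum) auto
  finally show ?thesis using H by (simp add: mat_trace_def)
qed

end

section \<open>From graphs to leader selection\<close>

lemma laplacian_carrier [simp]: "A \<in> carrier_mat n n \<Longrightarrow> laplacian A \<in> carrier_mat n n"
  by (auto simp: laplacian_def)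

lemma laplacian_index:
  assumes "A \<in> carrier_mat n n" "i < n" "j < n"
  shows "laplacian A $$ (i, j) = (if i = j then \<Sum>q<n. A $$ (i, q) else 0) - A $$ (i, j)"
  using assms by (auto simp: laplacian_def degree_matrix_def mat_diag_def)

text \<open>
  The Dirichlet energy of \<open>x\<close>; each edge is counted in both directions, whence the factor one
  half.
\<close>
lemma laplacian_quadratic_form:
  assumes A: "A \<in> carrier_mat n n" "transpose_mat A = A" and x: "x \<in> carrier_vec n"
  shows "x \<bullet> (laplacian A *\<^sub>v x) = 1 / 2 * (\<Sum>i<n. \<Sum>j<n. A $$ (i, j) * (x $ i - x $ j)\<^sup>2)"
proof -
  have A_commute: "A $$ (i, j) = A $$ (j, i)" if "i < n" "j < n" for i j
    using A that by (metis carrier_matD index_transpose_mat(1))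
  have Lx: "(laplacian A *\<^sub>v x) $ i = (\<Sum>j<n. A $$ (i, j) * (x $ i - x $ j))" if i: "i < n" for i
  proof -
    have "(laplacian A *\<^sub>v x) $ i = (\<Sum>j<n. laplacian A $$ (i, j) * x $ j)"
      using i x laplacian_carrier[OF A(1)] by (auto simp: scalar_prod_def atLeast0LessThan)
    also have "\<dots> = (\<Sum>j<n. (if j = i then (\<Sum>q<n. A $$ (i, q)) * x $ j else 0) - A $$ (i, j) * x $ j)"
      using i by (intro sum.cong) (auto simp: laplacian_index[OF A(1)] left_diff_distrib)
    also have "\<dots> = (\<Sum>j<n. A $$ (i, j) * (x $ i - x $ j))"
      using i by (simp add: sum_subtractf sum_distrib_right right_diff_distrib)
    finally show ?thesis .
  qed
  have "x \<bullet> (laplacian A *\<^sub>v x) = (\<Sum>i<n. x $ i * (laplacian A *\<^sub>v x) $ i)"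
    using carrier_matD[OF laplacian_carrier[OF A(1)]] by (simp add: scalar_prod_def atLeast0LessThan)
  also have "\<dots> = (\<Sum>i<n. \<Sum>j<n. A $$ (i, j) * (x $ i * (x $ i - x $ j)))"
    by (intro sum.cong) (auto simp: Lx sum_distrib_left mult.left_commute simp del: index_mult_mat_vec)
  finally have form: "x \<bullet> (laplacian A *\<^sub>v x) = (\<Sum>i<n. \<Sum>j<n. A $$ (i, j) * (x $ i * (x $ i - x $ j)))" .
  also have "\<dots> = (\<Sum>j<n. \<Sum>i<n. A $$ (i, j) * (x $ i * (x $ i - x $ j)))" by (rule sum.swap)
  also have "\<dots> = (\<Sum>i<n. \<Sum>j<n. A $$ (i, j) * (x $ j * (x $ j - x $ i)))"
    by (intro sum.cong refl) (simp add: A_commute)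
  finally have "2 * (x \<bullet> (laplacian A *\<^sub>v x)) =
      (\<Sum>i<n. \<Sum>j<n. A $$ (i, j) * (x $ i * (x $ i - x $ j)))
      + (\<Sum>i<n. \<Sum>j<n. A $$ (i, j) * (x $ j * (x $ j - x $ i)))" using form by simp
  also have "\<dots> = (\<Sum>i<n. \<Sum>j<n. A $$ (i, j) * (x $ i - x $ j)\<^sup>2)"
    unfolding sum.distrib[symmetric]
    by (intro sum.cong refl) (simp add: power2_eq_square algebra_simps)
  finally show ?thesis by simp
qed

text \<open>
  Zero Dirichlet energy forces \<open>x\<close> to agree across every edge, and connectivity carries the equality
  to every pair of nodes.
\<close>
lemma connected_laplacianI:
  fixes G :: "nat pair_pre_digraph"
  assumes G: "pverts G = {..<n}" "connected G" and A: "adjacency_matrix n G A"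
  shows "connected_laplacian n (laplacian A)"
proof -
  have Ac: "A \<in> carrier_mat n n" and A_sym: "transpose_mat A = A"
    using A by (auto simp: adjacency_matrix_def)
  have A_pos: "0 < A $$ (i, j)" if "(i, j) \<in> parcs G" "i < n" "j < n" for i j
    using A that by (auto simp: adjacency_matrix_def split: if_splits)
  have A_nonneg: "0 \<le> A $$ (i, j)" if "i < n" "j < n" for i j
    using A that by (cases "(i, j) \<in> parcs G") (force simp: adjacency_matrix_def)+
  have strong: "strongly_connected (with_proj (mk_symmetric (with_proj G)))"
    using G(2) by (simp add: connected_def)
  show ?thesis
  proof
    show Lc: "laplacian A \<in> carrier_mat n n" using Ac by simp
    show "transpose_mat (laplacian A) = laplacian A"
    proof (rule eq_matI)
      fix i j assume "i < dim_row (laplacian A)" "j < dim_col (laplacian A)"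
      then have "i < n" "j < n" using Lc by auto
      moreover from this have "A $$ (j, i) = A $$ (i, j)"
        using A_sym Ac by (metis carrier_matD index_transpose_mat(1))
      ultimately show "transpose_mat (laplacian A) $$ (i, j) = laplacian A $$ (i, j)"
        using carrier_matD[OF Lc] by (auto simp: laplacian_index[OF Ac])
    qed (use carrier_matD[OF Lc] in auto)
    show "(\<Sum>j<n. laplacian A $$ (i, j)) = 0" if "i < n" for i
      using that by (simp add: laplacian_index[OF Ac] sum_subtractf)
    show "0 \<le> x \<bullet> (laplacian A *\<^sub>v x)" if "x \<in> carrier_vec n" for x
      unfolding laplacian_quadratic_form[OF Ac A_sym that]
      by (intro mult_nonneg_nonneg sum_nonneg) (auto simp: A_nonneg)
    show "x $ u = x $ v"
      if x: "x \<in> carrier_vec n" and zero: "x \<bullet> (laplacian A *\<^sub>v x) = 0" and u: "u < n" and v: "v < n"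
      for x u v
    proof -
      have "(\<Sum>i<n. \<Sum>j<n. A $$ (i, j) * (x $ i - x $ j)\<^sup>2) = 0"
        using zero unfolding laplacian_quadratic_form[OF Ac A_sym x] by simp
      then have "\<forall>i\<in>{..<n}. (\<Sum>j<n. A $$ (i, j) * (x $ i - x $ j)\<^sup>2) = 0"
        by (subst (asm) sum_nonneg_eq_0_iff) (auto intro!: sum_nonneg simp: A_nonneg)
      then have "A $$ (i, j) * (x $ i - x $ j)\<^sup>2 = 0" if "i < n" "j < n" for i j
        using that sum_nonneg_eq_0_iff[of "{..<n}" "\<lambda>j. A $$ (i, j) * (x $ i - x $ j)\<^sup>2"]
        by (auto simp: A_nonneg)
      then have edge: "x $ i = x $ j" if "(i, j) \<in> parcs G" "i < n" "j < n" for i j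
        using A_pos[OF that] that(2,3) by fastforce
      have "(u, v) \<in> rtrancl_on {..<n} (parcs (mk_symmetric (with_proj G)))"
        using strong u v G(1) unfolding strongly_connected_def reachable_def
        by auto
      then show ?thesis
      proof (induction rule: rtrancl_on_induct)
        case (step y z)
        then have "(y, z) \<in> parcs G \<or> (z, y) \<in> parcs G" "y < n" "z < n"
          by (auto simp: parcs_mk_symmetric)
        then show ?case using edge step.IH by metis
      qed simp
    qed
    show "0 < n" using strong G(1) by (auto simp: strongly_connected_def)
  qed
qed

context leader_grounding
begin

text \<open>
  The zero row that pads \<open>G\<close> wipes out the first row of \<open>Q\<close>. Its trace is therefore the biharmonic sum
  over pairs of remaining leaders, and the sum of its first column the one over distances to \<open>l\<close>.
\<close>
lemma joint_centrality_eq: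
  assumes A: "A \<in> carrier_mat n n" and L: "L = laplacian A"
    and S: "S \<subseteq> {..<n}" "l \<in> S" and js: "js = other_leaders S l"
  shows "real n / joint_centrality A S l = mat_trace H"
proof -
  have dim: "dim_row A = n" "dim_col A = n" using A by auto
  have fin: "finite S" using S(1) finite_subset by blast
  have p: "card S = Suc p"
    using card.remove[OF fin S(2)] fin by (simp add: js other_leaders_def)
  have N_eq: "Ninv A l = N"
    by (simp add: Ninv_def grounded_inverse_def dim Let_def flip: L)
  have G_eq: "G_matrix A S l = Gm"
    by (simp add: G_matrix_def Gm_def N_eq flip: js)
  have biharm: "biharmonic_matrix A = mat n n (\<lambda>(i, j). biharmonic i j)"
    by (simp add: biharmonic_matrix_def biharmonic_def dim pseudoinverse_L_squared Let_def flip: L)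
  let ?Gamma = "principal_submatrix (biharmonic_matrix A) (l # other_leaders S l)"
  define Q where "Q = Q_matrix A S l"
  have Gamma: "?Gamma = mat (Suc p) (Suc p) (\<lambda>(a, b). biharmonic ((l # js) ! a) ((l # js) ! b))"
    using l_less
    by (intro eq_matI)
      (auto simp: principal_submatrix_def biharm js_nth nth_Cons split: nat.splits simp flip: js)
  have Gbar: "G_bar A S l = four_block_mat (0\<^sub>m 1 1) (0\<^sub>m 1 p) (0\<^sub>m p 1) Gm"
    by (simp add: G_bar_def G_eq p)
  have Gbar_c: "G_bar A S l \<in> carrier_mat (Suc p) (Suc p)"
    unfolding Gbar using four_block_carrier_mat[OF zero_carrier_mat[of 1 1] Gm(1)] by simp
  have Q: "Q \<in> carrier_mat (Suc p) (Suc p)"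
    unfolding Q_def Q_matrix_def Gamma by (rule mult_carrier_mat[OF Gbar_c]) simp
  have Q_index: "Q $$ (a, b) = (\<Sum>k<Suc p. G_bar A S l $$ (a, k) * biharmonic ((l # js) ! k) ((l # js) ! b))"
    if "a < Suc p" "b < Suc p" for a b
  proof -
    have "Q $$ (a, b) = (\<Sum>k<Suc p. G_bar A S l $$ (a, k) * ?Gamma $$ (k, b))"
      unfolding Q_def Q_matrix_def using that
      by (intro index_mult_mat_sum[OF Gbar_c]) (simp_all add: Gamma)
    then show ?thesis using that by (simp add: Gamma del: sum.lessThan_Suc)
  qed
  have Q_first: "Q $$ (0, b) = 0" if "b < Suc p" for b
    unfolding Q_index[OF zero_less_Suc that] using Gm(1)
    by (intro sum.neutral) (auto simp: Gbar)
  have Q_other: "Q $$ (Suc a, b) = (\<Sum>c<p. Gm $$ (a, c) * biharmonic (js ! c) ((l # js) ! b))"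
    if "a < p" "b < Suc p" for a b
  proof -
    have "Q $$ (Suc a, b) =
        (\<Sum>k<Suc p. G_bar A S l $$ (Suc a, k) * biharmonic ((l # js) ! k) ((l # js) ! b))"
      using that by (intro Q_index) auto
    also have "\<dots> = (\<Sum>c<p. G_bar A S l $$ (Suc a, Suc c) * biharmonic (js ! c) ((l # js) ! b))"
      using that Gm(1) unfolding sum.lessThan_Suc_shift by (simp add: Gbar)
    also have "\<dots> = (\<Sum>c<p. Gm $$ (a, c) * biharmonic (js ! c) ((l # js) ! b))"
      using that Gm(1) by (intro sum.cong) (auto simp: Gbar)
    finally show ?thesis .
  qed
  have trace_Q: "mat_trace Q = (\<Sum>a<p. \<Sum>b<p. Gm $$ (a, b) * biharmonic (js ! b) (js ! a))"
  proof -
    have "mat_trace Q = (\<Sum>a<Suc p. Q $$ (a, a))" using Q by (auto simp: mat_trace_def simp del: sum.lessThan_Suc)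
    also have "\<dots> = (\<Sum>a<p. Q $$ (Suc a, Suc a))"
      unfolding sum.lessThan_Suc_shift by (simp add: Q_first)
    also have "\<dots> = (\<Sum>a<p. \<Sum>b<p. Gm $$ (a, b) * biharmonic (js ! b) (js ! a))"
      by (intro sum.cong) (auto simp: Q_other)
    finally show ?thesis .
  qed
  have first_column: "vec (card S) (\<lambda>_. 1) \<bullet> (Q *\<^sub>v unit_vec (card S) 0) =
      (\<Sum>a<p. \<Sum>b<p. Gm $$ (a, b) * biharmonic (js ! b) l)"
  proof -
    have "vec (card S) (\<lambda>_. 1) \<bullet> (Q *\<^sub>v unit_vec (card S) 0) = (\<Sum>a<Suc p. (Q *\<^sub>v unit_vec (Suc p) 0) $ a)"
      using Q by (simp add: scalar_prod_def atLeast0LessThan p del: sum.lessThan_Suc)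
    also have "\<dots> = (\<Sum>a<Suc p. Q $$ (a, 0))"
      using Q by (intro sum.cong) auto
    also have "\<dots> = (\<Sum>a<p. Q $$ (Suc a, 0))"
      unfolding sum.lessThan_Suc_shift by (simp add: Q_first)
    also have "\<dots> = (\<Sum>a<p. \<Sum>b<p. Gm $$ (a, b) * biharmonic (js ! b) l)"
      by (intro sum.cong) (auto simp: Q_other)
    finally show ?thesis .
  qed
  have "joint_centrality A S l = real n * inverse (kirchhoff_index A / real n
      + real n * det Gm * det (principal_submatrix P (l # js))
      + 1 / 2 * mat_trace Q - vec (card S) (\<lambda>_. 1) \<bullet> (Q *\<^sub>v unit_vec (card S) 0))"
    by (simp only: joint_centrality_def Let_def dim G_eq Q_def flip: L js)
  also have "kirchhoff_index A / real n = mat_trace P"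
    using n_pos by (simp add: kirchhoff_index_def dim flip: L)
  also have "real n * det Gm * det (principal_submatrix P (l # js)) =
      real n * (det Gm * det (principal_submatrix P (l # js)))" by simp
  finally have "joint_centrality A S l = real n * inverse (mat_trace H)"
    by (simp only: trace_H_biharmonic det_leader_block trace_Q first_column)
  then show ?thesis using n_pos by (simp add: divide_inverse)
qed

end

lemma leader_groundingI:
  assumes "connected_laplacian n L" "S \<subseteq> {..<n}" "l \<in> S"
  shows "leader_grounding n L l (other_leaders S l)"
proof -
  have "finite S" using assms(2) finite_subset by blast
  then show ?thesis
    using assms unfolding leader_grounding_def leader_grounding_axioms_def other_leaders_def by auto
qed

text \<open>
  Strict inclusion of \<open>S\<close> provides a follower, without which the limit would be zero.
\<close>
lemma noise_free_error_limit:
  assumes conn: "connected_laplacian n (laplacian A)" and A: "A \<in> carrier_mat n n"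
    and S: "S \<subset> {..<n}" "l \<in> S"
  shows "(total_system_error A \<sigma> S \<longlongrightarrow> \<sigma>\<^sup>2 / 2 * (real n / joint_centrality A S l)) at_top"
    and "0 < joint_centrality A S l"
proof -
  have Sn: "S \<subseteq> {..<n}" "S \<noteq> {}" using S by auto
  interpret leader_grounding n "laplacian A" l "other_leaders S l"
    by (rule leader_groundingI[OF conn Sn(1) S(2)])
  have "finite S" using Sn(1) finite_subset by blast
  then have set_eq: "set (l # other_leaders S l) = S" using S(2) by (auto simp: other_leaders_def)
  note leader = H_leader_row[unfolded set_eq] and follower = L_H_follower_row[unfolded set_eq]
  have centrality: "real n / joint_centrality A S l = mat_trace H"
    by (rule joint_centrality_eq[OF A refl Sn(1) S(2) refl])
  have "0 < mat_trace H"
    by (rule grounded_trace_positive[OF S(1) Sn(2) H_carrier leader follower])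
  then show "0 < joint_centrality A S l"
    using n_pos by (simp add: zero_less_divide_iff flip: centrality)
  have "dim_row A = n" using A by simp
  then have error: "total_system_error A \<sigma> S =
      (\<lambda>k. mat_trace (steady_state_covariance (laplacian A + leader_gain n S k) \<sigma>))"
    by (simp add: total_system_error_def system_matrix_def fun_eq_iff)
  show "(total_system_error A \<sigma> S \<longlongrightarrow> \<sigma>\<^sup>2 / 2 * (real n / joint_centrality A S l)) at_top"
    unfolding error centrality
    by (rule noise_free_limit[OF Sn H_carrier H_sym leader follower])
qed

theorem theorem1:
  fixes n m :: nat and G :: "nat pair_pre_digraph" and A :: "real mat" and \<sigma> :: real
  assumes "pair_graph G" and "pverts G = {..<n}" and "connected G"
    and "adjacency_matrix n G A"
    and "\<sigma> > 0"
    and "1 \<le> m" and "m < n"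
  shows "(\<forall>S \<in> leader_sets n m. \<forall>l\<^sub>1 \<in> S.
            (total_system_error A \<sigma> S \<longlongrightarrow> \<sigma>\<^sup>2 / 2 * (real n / joint_centrality A S l\<^sub>1)) at_top)
       \<and> (\<forall>l\<^sub>1. (\<forall>T \<in> leader_sets n m. l\<^sub>1 T \<in> T) \<longrightarrow>
            (\<forall>S. optimal_noise_free_leaders A \<sigma> m S \<longleftrightarrow>
                 is_arg_max (\<lambda>T. joint_centrality A T (l\<^sub>1 T)) (\<lambda>T. T \<in> leader_sets n m) S))"
proof (intro conjI ballI allI impI)
  have A: "A \<in> carrier_mat n n" using assms(4) by (simp add: adjacency_matrix_def)
  have conn: "connected_laplacian n (laplacian A)"
    by (rule connected_laplacianI[OF assms(2,3,4)])
  have proper: "S \<subset> {..<n}" if "S \<in> leader_sets n m" for S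
    using that assms(7) by (auto simp: leader_sets_def)
  show "(total_system_error A \<sigma> S \<longlongrightarrow> \<sigma>\<^sup>2 / 2 * (real n / joint_centrality A S l)) at_top"
    if "S \<in> leader_sets n m" "l \<in> S" for S l
    by (rule noise_free_error_limit(1)[OF conn A proper[OF that(1)] that(2)])
  fix l :: "nat set \<Rightarrow> nat" and S
  assume l: "\<forall>T \<in> leader_sets n m. l T \<in> T"
  define \<rho> where "\<rho> T = joint_centrality A T (l T)" for T
  have pos: "0 < \<rho> T" if "T \<in> leader_sets n m" for T
    unfolding \<rho>_def using noise_free_error_limit(2)[OF conn A proper[OF that]] l that by blast
  have error: "noise_free_error A \<sigma> T = \<sigma>\<^sup>2 / 2 * (real n / \<rho> T)" if "T \<in> leader_sets n m" for T
    unfolding noise_free_error_def \<rho>_def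
    by (rule tendsto_Lim[OF _ noise_free_error_limit(1)[OF conn A proper[OF that]]])
      (use l that in auto)
  have "noise_free_error A \<sigma> T < noise_free_error A \<sigma> S \<longleftrightarrow> \<rho> S < \<rho> T"
    if "T \<in> leader_sets n m" "S \<in> leader_sets n m" for T S
    using assms(5,7) pos[OF that(1)] pos[OF that(2)]
    by (simp add: error[OF that(1)] error[OF that(2)] mult_less_cancel_left_pos divide_less_eq
        field_simps)
  moreover have "dim_row A = n" using A by simp
  ultimately show "optimal_noise_free_leaders A \<sigma> m S \<longleftrightarrow>
      is_arg_max (\<lambda>T. joint_centrality A T (l T)) (\<lambda>T. T \<in> leader_sets n m) S"
    unfolding optimal_noise_free_leaders_def is_arg_min_def is_arg_max_def \<rho>_def by blast
qed

end
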